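(* Let $s\ge1$, let $X=\{X_1,\dots,X_m\}$ be a family (repetitions allowed, $m\ge2$) of vectors in $\mathbb{Z}^s$ spanning $\mathbb{R}^s$ which is $\eta$-coplanar, and let $Y=\{Y_1,\dots,Y_{m'}\}$ be a family ($m'\ge2$) of vectors in $\mathbb{Z}^s$ spanning $\mathbb{R}^s$ which is $\eta'$-coplanar, where $\eta,\eta'\in\mathbb{R}^s$. Suppose $X$ and $Y$ define the same directional growth function, i.e. $\mathbf{C}_X=\mathbf{C}_Y$ and $\gamma_X=\gamma_Y$. Then $\eta=c\eta'$ for some $c>0$, and there exist integers $n,n'\ge1$ such that the $n$-th iteration of $X$ is a permutation of the $n'$-th iteration of $Y$.
   Context: $X$ is $\eta$-coplanar if $\langle\eta,X_j\rangle=1$ for all $j$. For a family $X$, $\mathbf{C}_X=X_1\mathbb{R}^++\dots+X_m\mathbb{R}^+$, $\mathcal{J}_X=X_1\mathbb{N}+\dots+X_m\mathbb{N}$ ($\mathbb{N}=\{0,1,\dots\}$); for $z\in\mathcal{J}_X$, $\mathbf{m}_X(z)$ is the number of finite words $i_1\cdots i_n$ ($i_k\in\{1,\dots,m\}$) with $X_{i_1}+\dots+X_{i_n}=z$; for $x\in\mathbf{C}_X$, $\mathbf{m}_X(x)=\min\{\mathbf{m}_X(z):z\in\mathcal{J}_X,\ \|x-z\|=d(x,\mathcal{J}_X)\}$; $\gamma_X(\theta)=\lim_{k\to\infty}\frac{\log\mathbf{m}_X(k\theta)}{k}$ for unit $\theta\in\mathbf{C}_X$. The $p$-th iteration of $X$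 is the family $X^{(p)}=\big(X_{i_1}+\dots+X_{i_p}\big)_{(i_1,\dots,i_p)\in\{1,\dots,m\}^p}$ of $m^p$ vectors (with repetitions). *)

theory Defs
  imports "HOL-Analysis.Analysis" "HOL-Library.Multiset"
begin

text \<open>
  A family \<open>X\<^sub>1, \<dots>, X\<^sub>m\<close> (repetitions allowed) is the list of its members; \<open>\<int>\<^sup>s\<close> sits inside
  \<open>\<real>\<^sup>s\<close> as the vectors with integer coordinates.
\<close>

definition integral_family :: "(real ^ 'n) list \<Rightarrow> bool" where
  "integral_family X \<longleftrightarrow> (\<forall>v \<in> set X. \<forall>i. v $ i \<in> \<int>)"

definition coplanar_family :: "real ^ 'n \<Rightarrow> (real ^ 'n) list \<Rightarrow> bool" where
  "coplanar_family \<eta> X \<longleftrightarrow> (\<forall>v \<in> set X. \<eta> \<bullet> v = 1)"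

definition family_cone :: "(real ^ 'n) list \<Rightarrow> (real ^ 'n) set" where
  "family_cone X =
     {(\<Sum>j<length X. c j *\<^sub>R X ! j) | c :: nat \<Rightarrow> real. \<forall>j<length X. 0 \<le> c j}"

definition family_semigroup :: "(real ^ 'n) list \<Rightarrow> (real ^ 'n) set" where
  "family_semigroup X = {(\<Sum>j<length X. real (c j) *\<^sub>R X ! j) | c :: nat \<Rightarrow> nat. True}"

text \<open>
  Words are words in the indices, so equal members at different positions are distinct letters.
  For a coplanar family every word with sum \<open>z\<close> has length \<open>\<eta> \<bullet> z\<close>, so the set is finite.
\<close>

definition word_count :: "(real ^ 'n) list \<Rightarrow> real ^ 'n \<Rightarrow> nat" where
  "word_count X z =
     card {w :: nat list. set w \<subseteq> {..<length X} \<and> (\<Sum>i\<leftarrow>w. X ! i) = z}"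

text \<open>
  The infimum of a nonempty set of naturals is its minimum. On \<open>family_semigroup X\<close> the only
  nearest point of \<open>x\<close> is \<open>x\<close> itself, so there this agrees with \<open>word_count X\<close>.
\<close>

definition multiplicity_at :: "(real ^ 'n) list \<Rightarrow> real ^ 'n \<Rightarrow> nat" where
  "multiplicity_at X x =
     Inf {word_count X z | z. z \<in> family_semigroup X \<and>
                              norm (x - z) = infdist x (family_semigroup X)}"

definition directional_growth :: "(real ^ 'n) list \<Rightarrow> real ^ 'n \<Rightarrow> real" where
  "directional_growth X \<theta> = lim (\<lambda>k :: nat. ln (real (multiplicity_at X (real k *\<^sub>R \<theta>))) / real k)"

definition same_directional_growth :: "(real ^ 'n) list \<Rightarrow> (real ^ 'n) list \<Rightarrow> bool" where
  "same_directional_growth X Y \<longleftrightarrow>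
     family_cone X = family_cone Y \<and>
     (\<forall>\<theta> \<in> family_cone X. norm \<theta> = 1 \<longrightarrow> directional_growth X \<theta> = directional_growth Y \<theta>)"

text \<open>
  \<open>List.n_lists p X\<close> lists all \<open>p\<close>-tuples of members of \<open>X\<close> by position, hence with repetitions:
  its length is \<open>length X ^ p\<close>.
\<close>

definition family_iteration :: "nat \<Rightarrow> (real ^ 'n) list \<Rightarrow> (real ^ 'n) list" where
  "family_iteration p X = map sum_list (List.n_lists p X)"

end

theory Submission
  imports Defs
    "HOL-Complex_Analysis.Conformal_Mappings"
    "HOL-Computational_Algebra.Fundamental_Theorem_Algebra"
    "HOL-Combinatorics.Multiset_Permutations"
    "HOL-Real_Asymp.Real_Asymp"
begin

text \<open>
  Put \<open>L\<^sub>X(t) = \<Sum>\<^sub>j exp(-\<langle>t,X\<^sub>j\<rangle>)\<close>. In the direction \<open>\<theta>\<close> of \<open>-\<nabla>L\<^sub>X(t)\<close> at a point with \<open>L\<^sub>X(t) = 1\<close>, the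
  growth is \<open>\<langle>t,\<theta>\<rangle>\<close>: counting words of a fixed length gives the upper bound, a multinomial coefficient
  the lower one. Hence the growth function is the support function of the convex set \<open>L\<^sub>X \<le> 1\<close>, and
  equal growth means that the hypersurfaces \<open>L\<^sub>X = 1\<close> and \<open>L\<^sub>Y = 1\<close> coincide.

  Since \<open>L\<^sub>X(t + a\<eta>) = exp(-a) L\<^sub>X(t)\<close>, every point is moved onto the hypersurface along \<open>\<eta>\<close>. Applied to
  the points \<open>-ln y \<sqdot> \<eta>'\<close>, this shows that \<open>p(y) = \<Sum>\<^sub>i y powr \<langle>\<eta>',X\<^sub>i\<rangle>\<close> and \<open>q(r) = \<Sum>\<^sub>j r powr \<langle>\<eta>,Y\<^sub>j\<rangle>\<close>
  satisfy \<open>q(1/p(y)) = 1/y\<close>. The exponents are rational, and continuing this identity to a complex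
  zero of \<open>p\<close> is contradictory, so \<open>p\<close> is a monomial and \<open>\<eta> = c\<eta>'\<close> with \<open>c\<close> rational. Then
  \<open>L\<^sub>Y = L\<^sub>X powr c\<close>, and the claim follows from the linear independence of exponentials.
\<close>

section \<open>Asymptotics of factorials and exponential sums\<close>

text \<open>A crude form of Stirling's formula, by induction: the increment of \<open>ln\<close>
  from \<open>n\<close> to \<open>Suc n\<close> lies between \<open>1 / Suc n\<close> and
  \<open>1 / n\<close>.\<close>

lemma ln_fact_bounds:
  assumes "n \<ge> 1"
  shows "real n * ln n - n \<le> ln (fact n)" "ln (fact n) \<le> real n * ln n - n + ln n + 1"
proof -
  have "real n * ln n - n \<le> ln (fact n) \<and> ln (fact n) \<le> real n * ln n - n + ln n + 1"
    using assms
  proof (induction n rule: dec_induct)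
    case base
    then show ?case by simp
  next
    case (step n)
    then have n: "real n > 0" by simp
    define d where "d = ln (real (Suc n)) - ln (real n)"
    have d: "d = ln (1 + 1 / real n)"
    proof -
      have "1 + 1 / real n = real (Suc n) / real n"
        using n by (simp add: field_simps)
      then show ?thesis using n unfolding d_def by (simp add: ln_div)
    qed
    have "d \<le> 1 / real n"
      unfolding d using n by (intro ln_add_one_self_le_self) auto
    then have d1: "real n * d \<le> 1"
      using n by (simp add: field_simps)
    have "- d = ln (real n / real (Suc n))"
      using n unfolding d_def by (simp add: ln_div)
    also have "\<dots> \<le> real n / real (Suc n) - 1"
      using n by (intro ln_le_minus_one) auto
    also have "\<dots> = - 1 / real (Suc n)"
      by (simp add: field_simps)
    finally have d2: "real (Suc n) * d \<ge> 1"
      by (simp add: field_simps)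
    have S: "ln (fact (Suc n)) = ln (fact n) + ln (real (Suc n))"
      by (simp add: ln_mult flip: of_nat_Suc)
    have L: "ln (real (Suc n)) = ln (real n) + d" by (simp add: d_def)
    show ?case
      using step.IH d1 d2 unfolding S L by (simp add: algebra_simps)
  qed
  then show "real n * ln n - n \<le> ln (fact n)" "ln (fact n) \<le> real n * ln n - n + ln n + 1"
    by auto
qed

text \<open>Subtracting \<open>n \<sqdot> ln k\<close> makes the logarithmic parts cancel in multinomial coefficients.\<close>

lemma ln_fact_asymptotics:
  fixes f :: "nat \<Rightarrow> nat"
  assumes lim: "(\<lambda>k. real (f k) / real k) \<longlonglongrightarrow> a" and "a > 0"
  shows "(\<lambda>k. (ln (fact (f k)) - real (f k) * ln k) / real k) \<longlonglongrightarrow> a * ln a - a"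
proof -
  have pos: "\<forall>\<^sub>F k in sequentially. real (f k) / real k > 0"
    using order_tendstoD(1)[OF lim \<open>a > 0\<close>] .
  have ftop: "filterlim (\<lambda>k. real (f k) / real k * real k) at_top sequentially"
    by (rule filterlim_tendsto_pos_mult_at_top[OF lim \<open>a > 0\<close> filterlim_real_sequentially])
  have ftop': "filterlim (\<lambda>k. real (f k)) at_top sequentially"
    by (rule filterlim_mono_eventually[OF ftop order_refl order_refl])
       (use eventually_gt_at_top[of "0::nat"] in eventually_elim, simp)
  have "((\<lambda>x::real. (ln x + 1) / x) \<longlongrightarrow> 0) at_top"
    by real_asymp
  from filterlim_compose[OF this ftop']
  have "(\<lambda>k. (ln (real (f k)) + 1) / real (f k)) \<longlonglongrightarrow> 0" .
  from tendsto_mult[OF this lim]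
  have err: "(\<lambda>k. (ln (real (f k)) + 1) / real (f k) * (real (f k) / real k)) \<longlonglongrightarrow> 0" by simp
  \<comment> \<open>The deviation from the main term of Stirling's formula. The parts with
    \<open>ln k\<close> cancel, so only the Stirling error divided by \<open>k\<close>
    remains.\<close>
  define g where "g k = (ln (fact (f k)) - real (f k) * ln k) / real k
     - (real (f k) / real k * ln (real (f k) / real k) - real (f k) / real k)" for k
  have "g \<longlonglongrightarrow> 0"
  proof (rule tendsto_sandwich[OF _ _ tendsto_const err])
    have *: "0 \<le> g k \<and> g k \<le> (ln (real (f k)) + 1) / real (f k) * (real (f k) / real k)"
      if "real (f k) / real k > 0" for k
    proof -
      have k: "real k > 0" "f k \<ge> 1" using that by (auto simp: zero_less_divide_iff)
      have "g k = (ln (fact (f k)) - (real (f k) * ln (f k) - f k)) / real k"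
        using k unfolding g_def by (simp add: ln_div field_simps)
      moreover have "(ln (real (f k)) + 1) / real (f k) * (real (f k) / real k) = (ln (real (f k)) + 1) / real k"
        using k by simp
      ultimately show ?thesis
        using ln_fact_bounds[OF k(2)] k by (auto intro!: divide_nonneg_nonneg divide_right_mono)
    qed
    show "\<forall>\<^sub>F k in sequentially. 0 \<le> g k"
      using pos by eventually_elim (use * in blast)
    show "\<forall>\<^sub>F k in sequentially. g k \<le> (ln (real (f k)) + 1) / real (f k) * (real (f k) / real k)"
      using pos by eventually_elim (use * in blast)
  qed
  moreover have "(\<lambda>k. real (f k) / real k * ln (real (f k) / real k) - real (f k) / real k)
      \<longlonglongrightarrow> a * ln a - a"
    using \<open>a > 0\<close> by (intro tendsto_intros lim) auto
  ultimately have "(\<lambda>k. g k + (real (f k) / real k * ln (real (f k) / real k) - real (f k) / real k))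
      \<longlonglongrightarrow> 0 + (a * ln a - a)"
    by (rule tendsto_add)
  then show ?thesis by (simp add: g_def)
qed

text \<open>Distinct exponentials are linearly independent. Along \<open>t = k v\<close>, where
  \<open>v\<close> has maximal norm among the vectors with nonzero coefficient, the term of
  \<open>v\<close> dominates all others; dividing by it and letting \<open>k\<close> grow gives
  \<open>c v = 0\<close>.\<close>

lemma exponential_sum_eq_0_imp_coeff_eq_0:
  fixes c :: "'a::real_inner \<Rightarrow> real"
  assumes "finite F" and zero: "\<And>t. (\<Sum>v\<in>F. c v * exp (t \<bullet> v)) = 0" and "u \<in> F"
  shows "c u = 0"
proof (rule ccontr)
  assume "c u \<noteq> 0"
  define G where "G = {v \<in> F. c v \<noteq> 0}"
  have G: "finite G" "G \<noteq> {}"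
    using assms \<open>c u \<noteq> 0\<close> unfolding G_def by auto
  then obtain v where v: "v \<in> G" "\<And>w. w \<in> G \<Longrightarrow> norm w \<le> norm v"
    using obtains_MAX[OF G, of norm thesis] Max_ge[of "norm ` G"] by (metis finite_imageI imageI)
  \<comment> \<open>A vector of maximal norm exposes itself: the direction \<open>v\<close> singles out its exponential.\<close>
  have less: "v \<bullet> w < v \<bullet> v" if "w \<in> G" "w \<noteq> v" for w
  proof -
    have "0 < norm (v - w) ^ 2" using that by simp
    also have "norm (v - w) ^ 2 = norm v ^ 2 - 2 * (v \<bullet> w) + norm w ^ 2"
      by (simp add: power2_norm_eq_inner inner_diff inner_commute)
    also have "norm w ^ 2 \<le> norm v ^ 2"
      using v(2)[OF that(1)] by (simp add: power_mono)
    finally show ?thesis by (simp add: power2_norm_eq_inner)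
  qed
  have eq: "(\<Sum>w\<in>G - {v}. c w * exp (real k * (v \<bullet> w - v \<bullet> v))) = - c v" for k
  proof -
    have "0 = (\<Sum>w\<in>F. c w * exp ((real k *\<^sub>R v) \<bullet> w)) * exp (- (real k * (v \<bullet> v)))"
      by (simp only: zero mult_zero_left)
    also have "(\<Sum>w\<in>F. c w * exp ((real k *\<^sub>R v) \<bullet> w)) = (\<Sum>w\<in>G. c w * exp ((real k *\<^sub>R v) \<bullet> w))"
      by (rule sum.mono_neutral_right) (use \<open>finite F\<close> in \<open>auto simp: G_def\<close>)
    also have "\<dots> * exp (- (real k * (v \<bullet> v))) = (\<Sum>w\<in>G. c w * exp (real k * (v \<bullet> w - v \<bullet> v)))"
      by (simp add: sum_distrib_right mult.assoc right_diff_distrib flip: exp_add)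
    also have "\<dots> = c v + (\<Sum>w\<in>G - {v}. c w * exp (real k * (v \<bullet> w - v \<bullet> v)))"
      by (subst sum.remove[OF G(1) v(1)]) simp
    finally show ?thesis by simp
  qed
  have "(\<lambda>k. \<Sum>w\<in>G - {v}. c w * exp (real k * (v \<bullet> w - v \<bullet> v))) \<longlonglongrightarrow> (\<Sum>w\<in>G - {v}. c w * 0)"
  proof (intro tendsto_sum tendsto_mult tendsto_const)
    fix w assume "w \<in> G - {v}"
    then have "v \<bullet> w - v \<bullet> v < 0" using less by simp
    then have "(\<lambda>k. exp (v \<bullet> w - v \<bullet> v) ^ k) \<longlonglongrightarrow> 0"
      by (intro LIMSEQ_realpow_zero) auto
    then show "(\<lambda>k. exp (real k * (v \<bullet> w - v \<bullet> v))) \<longlonglongrightarrow> 0"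
      by (simp add: exp_of_nat_mult)
  qed
  then have "(\<lambda>k::nat. - c v) \<longlonglongrightarrow> 0"
    unfolding eq by simp
  then have "- c v = 0" by (simp add: LIMSEQ_const_iff)
  then show False using v(1) by (simp add: G_def)
qed

section \<open>Rational determinants, bounded lattice vectors and sums over words\<close>

lemma det_Rats:
  fixes A :: "real^'n^'n"
  assumes "\<And>i j. A $ i $ j \<in> \<rat>"
  shows "det A \<in> \<rat>"
  unfolding det_def using assms by (intro Rats_sum Rats_prod Rats_mult) auto

lemma finite_bounded_integral_vectors:
  "finite {v :: real^'n. (\<forall>i. v $ i \<in> \<int>) \<and> norm v \<le> R}"
proof -
  let ?I = "{- \<lceil>R\<rceil> .. \<lceil>R\<rceil>}"
  have "finite ((\<lambda>f. \<chi> i. real_of_int (f i)) ` ((UNIV :: 'n set) \<rightarrow>\<^sub>E ?I))"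
    by (intro finite_imageI finite_PiE) auto
  moreover have "v \<in> (\<lambda>f. \<chi> i. of_int (f i)) ` (UNIV \<rightarrow>\<^sub>E ?I)"
    if "\<forall>i. v $ i \<in> \<int>" "norm v \<le> R" for v :: "real^'n"
  proof (rule image_eqI)
    show "v = (\<chi> i. of_int \<lfloor>v $ i\<rfloor>)"
      using that(1) by (simp add: vec_eq_iff)
    have "\<bar>v $ i\<bar> \<le> R" for i
      using component_le_norm_cart[of v i] that(2) by linarith
    then have "\<lfloor>v $ i\<rfloor> \<in> ?I" for i
      using that(1) abs_le_iff[of "v $ i" R] by (auto simp: le_floor_iff floor_le_iff minus_le_iff) linarith+
    then show "(\<lambda>i. \<lfloor>v $ i\<rfloor>) \<in> UNIV \<rightarrow>\<^sub>E ?I" by auto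
  qed
  ultimately show ?thesis
    by (auto elim!: finite_subset[rotated])
qed

text \<open>Expanding the power of a sum gives one product per word of length \<open>n\<close>. With
  exponential weights this controls numbers of words.\<close>

lemma sum_prod_list_words:
  fixes g :: "'a \<Rightarrow> 'b::comm_semiring_1"
  assumes "finite S"
  shows "(\<Sum>w | set w \<subseteq> S \<and> length w = n. prod_list (map g w)) = sum g S ^ n"
proof (induction n)
  case 0
  have "{w. set w \<subseteq> S \<and> length w = 0} = {[]}" by auto
  then show ?case by simp
next
  case (Suc n)
  have "(\<Sum>w | set w \<subseteq> S \<and> length w = Suc n. prod_list (map g w)) =
      (\<Sum>(w, a) \<in> {w. set w \<subseteq> S \<and> length w = n} \<times> S. prod_list (map g w) * g a)"
    unfolding lists_length_Suc_eq
    by (subst sum.reindex) (auto simp: inj_on_def case_prod_unfold mult.commute)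
  also have "\<dots> = (\<Sum>w | set w \<subseteq> S \<and> length w = n. prod_list (map g w)) * sum g S"
    by (simp add: sum_product sum.cartesian_product)
  finally show ?case using Suc by (simp add: mult.commute)
qed

section \<open>Mutually inverse power sums\<close>

lemma common_denominator:
  fixes A :: "real set"
  assumes "finite A" "A \<subseteq> \<rat>"
  obtains d :: nat where "d > 0" "\<And>a. a \<in> A \<Longrightarrow> real d * a \<in> \<int>"
proof -
  have "\<exists>d>0. \<forall>a\<in>A. real d * a \<in> \<int>"
    using assms
  proof (induction rule: finite_induct)
    case empty
    then show ?case by auto
  next
    case (insert x A)
    then obtain d where d: "d > 0" "\<forall>a\<in>A. real d * a \<in> \<int>" by auto
    obtain p :: int and q :: nat where q: "q > 0" "x = of_int p / of_nat q"
      using insert.prems by (auto simp: Rats_eq_int_div_nat)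
    have "real (d * q) * a \<in> \<int>" if "a \<in> insert x A" for a
    proof (cases "a = x")
      case True
      then have "real (d * q) * a = of_int (int d * p)" using q by simp
      then show ?thesis by (metis Ints_of_int)
    next
      case False
      then have "real d * a \<in> \<int>" using d(2) that by simp
      then have "real q * (real d * a) \<in> \<int>" by simp
      then show ?thesis by (simp add: mult_ac)
    qed
    then show ?case using d(1) q(1) by (intro exI[of _ "d * q"]) auto
  qed
  then show thesis using that by blast
qed

text \<open>
  A nonconstant \<open>\<Sum>i. z ^ k i\<close> has a root of minimal modulus \<open>\<rho> > 0\<close>. Its powers are holomorphic on
  the disc of radius \<open>\<rho>\<close>, so the identity persists there; multiplied by the largest power \<open>B\<close>,
  all its terms vanish at the root except the constant ones.
\<close>

lemma power_sum_identity_imp_exponent_0: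
  fixes k e :: "nat \<Rightarrow> nat" and b :: "nat \<Rightarrow> real"
  assumes id: "\<And>x::real. x > 0 \<Longrightarrow> (\<Sum>j<n. x ^ e j * (\<Sum>i<m. x ^ k i) powr (- b j)) = 1"
    and B: "B > 0" "\<And>j. j < n \<Longrightarrow> b j \<le> B" "\<And>j. j < n \<Longrightarrow> b j = B \<Longrightarrow> e j = 0"
    and j0: "j0 < n" "b j0 = B" and i0: "i0 < m" "k i0 = 0" and i1: "i1 < m"
  shows "k i1 = 0"
proof (rule ccontr)
  assume ki1: "k i1 \<noteq> 0"
  define P where "P = (\<Sum>i<m. monom (1::complex) (k i))"
  have poly_P: "poly P z = (\<Sum>i<m. z ^ k i)" for z
    by (simp add: P_def poly_sum poly_monom)
  \<comment> \<open>The coefficients count how often an exponent occurs, so nothing cancels.\<close>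
  have coeff_P: "coeff P (k i) \<noteq> 0" if "i < m" for i
  proof -
    have "coeff P (k i) = of_nat (card ({..<m} \<inter> {l. k l = k i}))"
      by (simp add: P_def coeff_sum sum.If_cases)
    moreover have "i \<in> {..<m} \<inter> {l. k l = k i}" using that by simp
    ultimately show ?thesis by (metis card_gt_0_iff empty_iff finite_Int finite_lessThan less_irrefl of_nat_eq_0_iff)
  qed
  have "degree P \<noteq> 0"
    using le_degree[OF coeff_P[OF i1]] ki1 by simp
  then have "{z. poly P z = 0} \<noteq> {}"
    using fundamental_theorem_of_algebra[of P] by (auto simp: constant_degree)
  moreover have fin: "finite {z. poly P z = 0}"
    using \<open>degree P \<noteq> 0\<close> by (intro poly_roots_finite) auto
  ultimately have "Min (norm ` {z. poly P z = 0}) \<in> norm ` {z. poly P z = 0}"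
    by (intro Min_in) auto
  then obtain z0 where z0: "poly P z0 = 0" "Min (norm ` {z. poly P z = 0}) = norm z0"
    by auto
  have z0_le: "norm z0 \<le> norm z" if "poly P z = 0" for z
    using that fin Min_le[of "norm ` {z. poly P z = 0}" "norm z"] by (simp add: z0(2))
  have P0: "poly P 0 \<noteq> 0"
    using coeff_P[OF i0(1)] i0(2) by (simp add: poly_0_coeff_0)
  define \<rho> where "\<rho> = norm z0"
  have \<rho>: "\<rho> > 0" using z0(1) P0 by (auto simp: \<rho>_def)
  let ?D = "ball (0::complex) \<rho>"
  have nz: "poly P z \<noteq> 0" if "z \<in> ?D" for z
    using z0_le[of z] that by (auto simp: \<rho>_def)
  have "poly P holomorphic_on ?D"
    unfolding poly_P by (intro holomorphic_intros)
  then obtain g0 where g0: "g0 holomorphic_on ?D" "\<And>z. z \<in> ?D \<Longrightarrow> exp (g0 z) = poly P z"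
    using holomorphic_logarithm_exists[of ?D "poly P" 0] nz \<rho> by auto
  define \<pi> where "\<pi> x = (\<Sum>i<m. x ^ k i)" for x :: real
  have \<pi>: "poly P (of_real x) = of_real (\<pi> x)" for x
    by (simp add: poly_P \<pi>_def)
  have \<pi>_pos: "\<pi> x > 0" if "x \<ge> 0" for x
    unfolding \<pi>_def using i0 that by (intro sum_pos2[of _ i0]) auto
  \<comment> \<open>The branch of the logarithm of \<open>poly P\<close> on the disc that is real at
    0.\<close>
  define g where "g z = g0 z - g0 0 + of_real (ln (\<pi> 0))" for z
  have g_hol: "g holomorphic_on ?D"
    unfolding g_def by (intro holomorphic_intros g0)
  have exp_g: "exp (g z) = poly P z" if "z \<in> ?D" for z
  proof -
    have "exp (g z) = exp (g0 z) / exp (g0 0) * exp (of_real (ln (\<pi> 0)))"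
      by (simp add: g_def exp_add exp_diff)
    also have "exp (of_real (ln (\<pi> 0))) = poly P 0"
      using \<pi>[of 0] \<pi>_pos[of 0] by (simp add: exp_of_real)
    also have "exp (g0 0) = poly P 0" using g0(2) \<rho> by simp
    finally show ?thesis using g0(2)[OF that] P0 by simp
  qed
  have "continuous_on ?D g" using g_hol by (rule holomorphic_on_imp_continuous_on)
  then have "isCont g 0" using \<rho> by (simp add: continuous_on_eq_continuous_at)
  then have "((\<lambda>z. Im (g z)) \<longlongrightarrow> Im (g 0)) (at 0)"
    by (intro tendsto_intros) (simp add: isCont_def)
  moreover have "Im (g 0) = 0" by (simp add: g_def)
  ultimately have "\<forall>\<^sub>F z in at 0. dist (Im (g z)) 0 < pi"
    by (intro tendstoD) auto
  then obtain \<epsilon>0 where \<epsilon>0: "\<epsilon>0 > 0" "\<And>z. z \<noteq> 0 \<Longrightarrow> norm z < \<epsilon>0 \<Longrightarrow> \<bar>Im (g z)\<bar> < pi"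
    unfolding eventually_at by auto
  define \<epsilon> where "\<epsilon> = min \<epsilon>0 \<rho>"
  have \<epsilon>: "\<epsilon> > 0" using \<epsilon>0 \<rho> by (simp add: \<epsilon>_def)
  \<comment> \<open>By continuity the imaginary part of \<open>g\<close> stays below
    \<open>pi\<close> near 0, so there \<open>g\<close> is the principal logarithm and agrees with
    \<open>ln\<close> on positive reals.\<close>
  have g_real: "g (of_real x) = of_real (ln (\<pi> x))" if x: "0 < x" "x < \<epsilon>" for x
  proof -
    have "\<bar>Im (g (of_real x))\<bar> < pi"
      using \<epsilon>0(2)[of "of_real x"] x by (simp add: \<epsilon>_def)
    then have "Ln (exp (g (of_real x))) = g (of_real x)"
      by (intro Ln_exp) auto
    moreover have "exp (g (of_real x)) = of_real (\<pi> x)"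
      using exp_g[of "of_real x"] x \<pi> by (simp add: \<epsilon>_def)
    ultimately show ?thesis
      using Ln_of_real[of "\<pi> x"] \<pi>_pos[of x] x by simp
  qed
  define \<Phi> where "\<Phi> z = (\<Sum>j<n. z ^ e j * exp (- of_real (b j) * g z)) - 1" for z
  \<comment> \<open>The positive reals below \<open>\<epsilon>\<close>, where the hypothesis
    applies, accumulate at 0; the identity theorem extends the equation to the whole disc.\<close>
  have \<Phi>0: "\<Phi> w = 0" if "w \<in> ?D" for w
  proof (rule analytic_continuation[of \<Phi> ?D "of_real ` {0<..<\<epsilon>}" 0])
    show "\<Phi> holomorphic_on ?D"
      unfolding \<Phi>_def by (intro holomorphic_intros g_hol)
    show "of_real ` {0<..<\<epsilon>} \<subseteq> ?D" by (auto simp: \<epsilon>_def)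
    show "(0::complex) islimpt of_real ` {0<..<\<epsilon>}"
      unfolding islimpt_approachable
    proof (intro allI impI)
      fix r :: real assume "r > 0"
      then show "\<exists>x'\<in>of_real ` {0<..<\<epsilon>}. x' \<noteq> 0 \<and> dist x' (0::complex) < r"
        using \<epsilon> by (intro bexI[OF _ imageI[of "min r \<epsilon> / 2"]]) auto
    qed
    fix z :: complex assume "z \<in> of_real ` {0<..<\<epsilon>}"
    then obtain x where x: "z = of_real x" "0 < x" "x < \<epsilon>" by auto
    have "exp (- of_real (b j) * g z) = of_real (\<pi> x powr (- b j))" for j
      using \<pi>_pos[of x] x by (simp add: x(1) g_real powr_def flip: exp_of_real)
    then have "\<Phi> z = of_real ((\<Sum>j<n. x ^ e j * \<pi> x powr (- b j)) - 1)"
      by (simp add: \<Phi>_def x(1))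
    then show "\<Phi> z = 0" using id[OF x(2)] by (simp add: \<pi>_def)
  qed (use that \<rho> in auto)
  \<comment> \<open>After multiplication by \<open>exp (B * g z)\<close> each term in
    \<open>J\<close> equals 1, because \<open>e\<close> vanishes there. \<open>H\<close> bounds the
    remaining terms on the segment from 0 to \<open>z0\<close>, hence is at least
    \<open>card J\<close>.\<close>
  define J where "J = {j \<in> {..<n}. b j = B}"
  define H where "H \<tau> = norm (poly P (of_real \<tau> * z0)) powr B +
      (\<Sum>j\<in>{..<n} - J. norm (of_real \<tau> * z0) ^ e j * norm (poly P (of_real \<tau> * z0)) powr (B - b j))" for \<tau>
  have H_ge: "1 \<le> H \<tau>" if \<tau>: "0 \<le> \<tau>" "\<tau> < 1" for \<tau>
  proof -
    define z where "z = of_real \<tau> * z0"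
    have z: "z \<in> ?D"
      using \<tau> \<rho> by (simp add: z_def norm_mult \<rho>_def)
    have pw: "norm (exp (of_real s * g z)) = norm (poly P z) powr s" for s
      using exp_g[OF z] by (simp add: powr_def flip: exp_g[OF z])
    have "(\<Sum>j<n. z ^ e j * exp (- of_real (b j) * g z)) = 1"
      using \<Phi>0[OF z] by (simp add: \<Phi>_def)
    then have "exp (of_real B * g z) = exp (of_real B * g z) * (\<Sum>j<n. z ^ e j * exp (- of_real (b j) * g z))"
      by simp
    also have "\<dots> = (\<Sum>j<n. z ^ e j * exp (of_real (B - b j) * g z))"
      unfolding sum_distrib_left
      by (intro sum.cong refl) (simp add: left_diff_distrib exp_diff exp_minus field_simps)
    also have "\<dots> = (\<Sum>j\<in>{..<n} - J. z ^ e j * exp (of_real (B - b j) * g z)) +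
        (\<Sum>j\<in>J. z ^ e j * exp (of_real (B - b j) * g z))"
      by (rule sum.subset_diff) (auto simp: J_def)
    also have "(\<Sum>j\<in>J. z ^ e j * exp (of_real (B - b j) * g z)) = of_nat (card J)"
      by (subst sum.cong[OF refl, of _ _ "\<lambda>_. 1"]) (auto simp: J_def B(3))
    finally have "of_nat (card J) = exp (of_real B * g z) -
        (\<Sum>j\<in>{..<n} - J. z ^ e j * exp (of_real (B - b j) * g z))"
      by simp
    then have "real (card J) = norm (exp (of_real B * g z) -
        (\<Sum>j\<in>{..<n} - J. z ^ e j * exp (of_real (B - b j) * g z)))"
      by (metis norm_of_nat)
    also have "\<dots> \<le> norm (exp (of_real B * g z)) +
        (\<Sum>j\<in>{..<n} - J. norm (z ^ e j * exp (of_real (B - b j) * g z)))"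
      by (intro norm_triangle_le_diff add_left_mono norm_sum)
    also have "\<dots> = H \<tau>"
      unfolding H_def z_def[symmetric] by (simp only: norm_mult norm_power pw)
    finally have "real (card J) \<le> H \<tau>" .
    moreover have "card J > 0"
      using j0 by (auto simp: J_def card_gt_0_iff)
    ultimately show ?thesis by linarith
  qed
  have "(H \<longlongrightarrow> norm (poly P (of_real 1 * z0)) powr B +
      (\<Sum>j\<in>{..<n} - J. norm (of_real 1 * z0) ^ e j * norm (poly P (of_real 1 * z0)) powr (B - b j))) (at_left 1)"
    unfolding H_def
  proof (intro tendsto_add tendsto_sum tendsto_mult tendsto_powr')
    have P_lim: "((\<lambda>\<tau>. poly P (of_real \<tau> * z0)) \<longlongrightarrow> poly P (of_real 1 * z0)) (at_left 1)"
      unfolding poly_P by (intro tendsto_intros)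
    then show "((\<lambda>\<tau>. norm (poly P (of_real \<tau> * z0))) \<longlongrightarrow> norm (poly P (of_real 1 * z0))) (at_left 1)"
      by (rule tendsto_norm)
    then show "((\<lambda>\<tau>. norm (poly P (of_real \<tau> * z0))) \<longlongrightarrow> norm (poly P (of_real 1 * z0))) (at_left 1)" .
    show "((\<lambda>\<tau>. norm (of_real \<tau> * z0) ^ e j) \<longlongrightarrow> norm (of_real 1 * z0) ^ e j) (at_left 1)" for j
      by (intro tendsto_intros)
    \<comment> \<open>Outside \<open>J\<close> the exponent \<open>B - b j\<close> is positive, so
      the power tends to 0 together with its base.\<close>
    fix j assume "j \<in> {..<n} - J"
    then have "b j < B" using B(2)[of j] by (auto simp: J_def less_le)
    then show "norm (poly P (of_real 1 * z0)) \<noteq> 0 \<or>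
        0 < B - b j \<and> (\<forall>\<^sub>F \<tau> in at_left 1. 0 \<le> norm (poly P (of_real \<tau> * z0)))" by simp
  qed (use B(1) in \<open>auto intro: tendsto_const\<close>)
  moreover have "norm (poly P (of_real 1 * z0)) powr B +
      (\<Sum>j\<in>{..<n} - J. norm (of_real 1 * z0) ^ e j * norm (poly P (of_real 1 * z0)) powr (B - b j)) = 0"
    using z0(1) B(1) by simp
  ultimately have "(H \<longlongrightarrow> 0) (at_left 1)" by simp
  moreover have "\<forall>\<^sub>F \<tau> in at_left 1. 1 \<le> H \<tau>"
    using eventually_at_left_real[of 0 1] by (rule eventually_mono) (auto intro: H_ge)
  ultimately have "(1::real) \<le> 0"
    by (rule tendsto_lowerbound) simp
  then show False by simp
qed

text \<open>Substituting \<open>y = x ^ d\<close> for a common denominator \<open>d\<close> and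
  pulling the smallest power out of the inner sum reduces the identity to one with natural
  exponents, in which the inner sum has a nonzero constant term.\<close>

lemma inverse_power_sums_imp_equal_exponents:
  fixes a b :: "nat \<Rightarrow> real"
  assumes a: "\<And>i. i < m \<Longrightarrow> a i > 0" "\<And>i. i < m \<Longrightarrow> a i \<in> \<rat>"
    and b: "\<And>j. j < n \<Longrightarrow> b j > 0" "\<And>j. j < n \<Longrightarrow> b j \<in> \<rat>"
    and id: "\<And>y. y > 0 \<Longrightarrow> (\<Sum>j<n. (\<Sum>i<m. y powr a i) powr (- b j)) = 1 / y"
    and ij: "i < m" "j < m"
  shows "a i = a j"
proof -
  have n: "n > 0" using id[of 1] by (cases n) auto
  have m: "{..<m} \<noteq> {}" using ij by auto
  have "Min (a ` {..<m}) \<in> a ` {..<m}" using m by (intro Min_in) auto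
  then obtain i0 where i0: "i0 < m" "Min (a ` {..<m}) = a i0" by auto
  then have i0_le: "a i0 \<le> a i" if "i < m" for i
    using that Min_le[of "a ` {..<m}" "a i"] by simp
  have "Max (b ` {..<n}) \<in> b ` {..<n}" using n by (intro Max_in) auto
  then obtain j0 where j0: "j0 < n" "Max (b ` {..<n}) = b j0" by auto
  then have j0_ge: "b j \<le> b j0" if "j < n" for j
    using that Max_ge[of "b ` {..<n}" "b j"] by simp
  \<comment> \<open>The products \<open>a i0 * b j\<close> become exponents once the smallest power
    is pulled out of the inner sum.\<close>
  let ?A = "a ` {..<m} \<union> (\<lambda>j. a i0 * b j) ` {..<n}"
  have "?A \<subseteq> \<rat>" using a b i0 by auto
  then obtain d where d: "d > 0" "\<And>x. x \<in> ?A \<Longrightarrow> real d * x \<in> \<int>"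
    using common_denominator[of ?A] by blast
  define k where "k i = nat \<lfloor>real d * a i - real d * a i0\<rfloor>" for i
  have k: "real (k i) = real d * a i - real d * a i0" if "i < m" for i
  proof -
    have "real d * a i - real d * a i0 \<in> \<int>" using d(2) that i0(1) by auto
    moreover have "real d * a i - real d * a i0 \<ge> 0"
      using i0_le[OF that] d(1) by (simp add: mult_left_mono)
    ultimately show ?thesis by (simp add: k_def)
  qed
  define \<beta> where "\<beta> j = nat \<lfloor>real d * (a i0 * b j)\<rfloor>" for j
  have \<beta>: "real (\<beta> j) = real d * (a i0 * b j)" if "j < n" for j
  proof -
    have "real d * (a i0 * b j) \<in> \<int>" using d(2) that by auto
    moreover have "real d * (a i0 * b j) \<ge> 0"
      using a(1)[OF i0(1)] b(1)[OF that] by simp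
    ultimately show ?thesis by (simp add: \<beta>_def)
  qed
  have \<beta>_le: "\<beta> j \<le> \<beta> j0" if "j < n" for j
  proof -
    have "real (\<beta> j) \<le> real (\<beta> j0)"
      using that j0(1) j0_ge a(1)[OF i0(1)] d(1) by (simp add: \<beta> mult_left_mono)
    then show ?thesis by simp
  qed
  \<comment> \<open>Multiplying the identity by \<open>x ^ \<beta> j0\<close> turns the exponents
    \<open>- \<beta> j\<close> into naturals, which vanish where \<open>b j\<close> is
    maximal.\<close>
  define e where "e j = \<beta> j0 - \<beta> j" for j
  define \<pi> where "\<pi> x = (\<Sum>i<m. x ^ k i)" for x :: real
  define F where "F x = (\<Sum>j<n. x ^ e j * \<pi> x powr (- b j))" for x
  have k0: "k i0 = 0" by (simp add: k_def)
  have \<pi>_pos: "\<pi> x > 0" if "x \<ge> 0" for x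
    unfolding \<pi>_def using i0 k0 that by (intro sum_pos2[of _ i0]) auto
  have F_eq: "F x = x powr (real (\<beta> j0) - real d)" if x: "x > 0" for x
  proof -
    have "(x ^ d) powr a i = x powr (real d * a i0) * x ^ k i" if "i < m" for i
      using x k[OF that] by (simp add: powr_powr powr_diff flip: powr_realpow)
    then have p: "(\<Sum>i<m. (x ^ d) powr a i) = x powr (real d * a i0) * \<pi> x"
      unfolding \<pi>_def by (simp add: sum_distrib_left)
    have "(\<Sum>j<n. x powr (- real (\<beta> j)) * \<pi> x powr (- b j)) = (\<Sum>j<n. (\<Sum>i<m. (x ^ d) powr a i) powr (- b j))"
      unfolding p using x \<pi>_pos[of x] by (intro sum.cong refl) (simp add: powr_mult powr_powr \<beta> mult.assoc)
    also have "\<dots> = x powr (- real d)"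
      using id[of "x ^ d"] x by (simp add: powr_minus_divide powr_realpow)
    finally have *: "(\<Sum>j<n. x powr (- real (\<beta> j)) * \<pi> x powr (- b j)) = x powr (- real d)" .
    have "F x = (\<Sum>j<n. x powr real (\<beta> j0) * (x powr (- real (\<beta> j)) * \<pi> x powr (- b j)))"
      unfolding F_def
    proof (intro sum.cong refl)
      fix j assume "j \<in> {..<n}"
      then have "x ^ e j = x powr (real (\<beta> j0) + - real (\<beta> j))"
        using x \<beta>_le[of j] by (simp add: e_def of_nat_diff flip: powr_realpow)
      then show "x ^ e j * \<pi> x powr - b j = x powr real (\<beta> j0) * (x powr - real (\<beta> j) * \<pi> x powr - b j)"
        by (simp only: powr_add mult.assoc)
    qed
    also have "\<dots> = x powr (real (\<beta> j0) + - real d)"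
      unfolding sum_distrib_left[symmetric] * powr_add ..
    finally show ?thesis by simp
  qed
  have F_lim: "(F \<longlongrightarrow> F 0) (at_right 0)"
    unfolding F_def \<pi>_def
    by (intro tendsto_intros) (use \<pi>_pos[of 0] in \<open>auto simp: \<pi>_def\<close>)
  have F0: "F 0 > 0"
    unfolding F_def using j0(1) \<pi>_pos[of 0]
    by (intro sum_pos2[of _ j0]) (auto simp: e_def)
  have pos: "\<forall>\<^sub>F x in at_right (0::real). x > 0"
    by (rule eventually_at_right_less)
  \<comment> \<open>\<open>F\<close> has the positive limit \<open>F 0\<close> at 0 from the right,
    yet it equals a pure power of \<open>x\<close>; so the exponent must be 0.\<close>
  have "real (\<beta> j0) = real d"
  proof (rule ccontr)
    assume ne: "real (\<beta> j0) \<noteq> real d"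
    define s where "s = real (\<beta> j0) - real d"
    have vanish: "((\<lambda>x. x powr r) \<longlongrightarrow> 0) (at_right (0::real))" if "r > 0" for r
      using that by real_asymp
    show False
    proof (cases "s > 0")
      case True
      have "(F \<longlongrightarrow> 0) (at_right 0)"
        by (rule Lim_transform_eventually[OF vanish[OF True]])
           (use pos in eventually_elim, simp add: F_eq s_def)
      then have "F 0 = 0" using F_lim tendsto_unique by (metis trivial_limit_at_right_real)
      then show False using F0 by simp
    next
      case False
      then have s: "- s > 0" using ne by (simp add: s_def)
      have "((\<lambda>x. F x * x powr (- s)) \<longlongrightarrow> F 0 * 0) (at_right 0)"
        by (intro tendsto_mult F_lim vanish s)
      moreover have "\<forall>\<^sub>F x in at_right 0. F x * x powr (- s) = 1"
        using pos by eventually_elim (simp add: F_eq s_def flip: powr_add)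
      ultimately have "((\<lambda>x. 1::real) \<longlongrightarrow> F 0 * 0) (at_right (0::real))"
        by (rule Lim_transform_eventually)
      then show False by (simp add: tendsto_const_iff)
    qed
  qed
  then have F1: "F x = 1" if "x > 0" for x
    using F_eq[OF that] that by simp
  have "k i = 0" if "i < m" for i
  proof (rule power_sum_identity_imp_exponent_0[where k = k and e = e and b = b and n = n and m = m and ?i0.0 = i0 and
        ?i1.0 = i and ?j0.0 = j0 and B = "b j0"])
    show "(\<Sum>j<n. x ^ e j * (\<Sum>i<m. x ^ k i) powr - b j) = 1" if "x > 0" for x :: real
      using F1[OF that] by (simp add: F_def \<pi>_def)
    show "e j = 0" if "j < n" "b j = b j0" for j
      using that by (simp add: e_def \<beta>_def)
  qed (use that i0(1) k0 j0(1) j0_ge b in auto)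
  then have "real d * a i = real d * a i0" "real d * a j = real d * a i0"
    using k ij by force+
  then show ?thesis using d(1) by simp
qed

section \<open>The growth function as a support function\<close>

text \<open>The Laplace transform of the counting measure of the family.\<close>

definition expsum :: "(real^'n) list \<Rightarrow> real^'n \<Rightarrow> real" where
  "expsum X t = (\<Sum>j<length X. exp (- (t \<bullet> X ! j)))"

text \<open>Minus the gradient of \<open>expsum X\<close> at \<open>t\<close>. On the hypersurface
  \<open>expsum X t = 1\<close> the weights form a probability vector and this is its mean.\<close>

definition tilted_mean :: "(real^'n) list \<Rightarrow> real^'n \<Rightarrow> real^'n" where
  "tilted_mean X t = (\<Sum>j<length X. exp (- (t \<bullet> X ! j)) *\<^sub>R X ! j)"

lemma continuous_on_expsum [continuous_intros]:
  "continuous_on S f \<Longrightarrow> continuous_on S (\<lambda>x. expsum X (f x))"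
  unfolding expsum_def by (intro continuous_intros)

text \<open>Convexity: the graph lies above its tangent hyperplanes, by
  \<open>1 + x \<le> exp x\<close> in each term.\<close>

lemma expsum_tangent: "expsum X s - (t - s) \<bullet> tilted_mean X s \<le> expsum X t"
proof -
  have "expsum X s - (t - s) \<bullet> tilted_mean X s =
      (\<Sum>j<length X. exp (- (s \<bullet> X ! j)) * (1 + (s - t) \<bullet> X ! j))"
    unfolding expsum_def tilted_mean_def
    by (simp add: inner_sum_right inner_diff_left sum_subtractf algebra_simps sum.distrib)
  also have "\<dots> \<le> (\<Sum>j<length X. exp (- (s \<bullet> X ! j)) * exp ((s - t) \<bullet> X ! j))"
    by (intro sum_mono mult_left_mono exp_ge_add_one_self) auto
  also have "\<dots> = expsum X t"
    unfolding expsum_def by (simp add: inner_diff_left flip: exp_add)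
  finally show ?thesis .
qed

lemma expsum_has_derivative_along_line:
  "((\<lambda>e. expsum X (t + e *\<^sub>R v)) has_real_derivative - (v \<bullet> tilted_mean X t)) (at 0)"
  unfolding expsum_def tilted_mean_def
  by (auto intro!: derivative_eq_intros simp: inner_sum_right inner_add_left sum_negf mult.commute)

lemma sum_mset_replicate_family:
  fixes f :: "nat \<Rightarrow> 'a::real_vector"
  shows "(\<Sum>i\<in>#(\<Sum>j<m. replicate_mset (n j) j). f i) = (\<Sum>j<m. real (n j) *\<^sub>R f j)"
proof (induction m)
  case (Suc m)
  have "(\<Sum>i\<in>#replicate_mset k m. f i) = real k *\<^sub>R f m" for k
    by (induction k) (auto simp: algebra_simps)
  with Suc show ?case by simp
qed simp

lemma integral_vectors_dist_less_1_imp_eq: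
  fixes x y :: "real^'n"
  assumes "\<forall>i. x $ i \<in> \<int>" "\<forall>i. y $ i \<in> \<int>" "dist y x < 1"
  shows "y = x"
proof -
  have "y $ i - x $ i = 0" for i
  proof (rule Ints_nonzero_abs_less1)
    show "\<bar>y $ i - x $ i\<bar> < 1"
      using component_le_norm_cart[of "y - x" i] assms(3) by (simp add: dist_norm)
  qed (use assms in auto)
  then show ?thesis by (simp add: vec_eq_iff)
qed

locale coplanar_lattice_family =
  fixes X :: "(real^'n) list" and \<eta> :: "real^'n"
  assumes integral: "integral_family X"
    and spanning: "span (set X) = UNIV"
    and coplanar: "coplanar_family \<eta> X"
begin

lemma nonempty: "X \<noteq> []"
proof
  assume "X = []"
  then have "(UNIV :: (real^'n) set) = {0}" using spanning by simp
  then have "(1 :: real^'n) = 0" by (metis UNIV_I singletonD)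
  then show False by simp
qed

lemma inner_member [simp]: "j < length X \<Longrightarrow> \<eta> \<bullet> X ! j = 1"
  using coplanar by (simp add: coplanar_family_def)

lemma expsum_pos: "expsum X t > 0"
  unfolding expsum_def using nonempty by (intro sum_pos) auto

lemma expsum_shift: "expsum X (t + a *\<^sub>R \<eta>) = exp (- a) * expsum X t"
  unfolding expsum_def by (auto simp: sum_distrib_left inner_add_left simp flip: exp_add intro!: sum.cong)

lemma inner_tilted_mean: "\<eta> \<bullet> tilted_mean X t = expsum X t"
  unfolding expsum_def tilted_mean_def by (simp add: inner_sum_right)

lemma eq_iff_inner_members: "u = v \<longleftrightarrow> (\<forall>j<length X. u \<bullet> X ! j = v \<bullet> X ! j)"
proof
  assume *: "\<forall>j<length X. u \<bullet> X ! j = v \<bullet> X ! j"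
  have "(u - v) \<bullet> x = 0" if "x \<in> span (set X)" for x
    using that by (induction rule: span_induct_alt)
      (use * in \<open>auto simp: in_set_conv_nth inner_simps\<close>)
  then have "(u - v) \<bullet> (u - v) = 0" using spanning by blast
  then show "u = v" by simp
qed simp

text \<open>The pairing with \<open>\<eta>\<close> is the sum of the cone coefficients. Applied to
  the members of another family with the same cone, it yields positive exponents.\<close>

lemma inner_cone_pos:
  assumes "x \<in> family_cone X" "x \<noteq> 0"
  shows "\<eta> \<bullet> x > 0"
proof -
  obtain c where c: "x = (\<Sum>j<length X. c j *\<^sub>R X ! j)" "\<forall>j<length X. 0 \<le> c j"
    using assms(1) unfolding family_cone_def by auto
  have "\<eta> \<bullet> x = (\<Sum>j<length X. c j)"
    unfolding c(1) by (simp add: inner_sum_right)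
  moreover have "\<exists>j<length X. c j \<noteq> 0"
    using assms(2) unfolding c(1) by (metis (no_types, lifting) lessThan_iff scale_eq_0_iff sum.neutral)
  ultimately show ?thesis
    using c(2) by (metis (mono_tags, lifting) finite_lessThan lessThan_iff less_eq_real_def sum_pos2)
qed

lemma member_cone: "j < length X \<Longrightarrow> X ! j \<in> family_cone X"
  unfolding family_cone_def
  by (rule CollectI, rule exI[of _ "\<lambda>i. if i = j then 1 else 0"])
     (auto simp: if_distrib[of "\<lambda>a. a *\<^sub>R _"] cong: if_cong)

lemma member_nonzero: "j < length X \<Longrightarrow> X ! j \<noteq> 0"
  using inner_member by fastforce

lemma semigroup_integral:
  assumes "z \<in> family_semigroup X"
  shows "z $ i \<in> \<int>"
proof -
  have "X ! j $ i \<in> \<int>" if "j < length X" for j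
    using integral that by (simp add: integral_family_def)
  then show ?thesis
    using assms unfolding family_semigroup_def by (auto intro!: Ints_sum Ints_mult)
qed

section \<open>Upper and lower bounds for word counts\<close>

lemma inner_word:
  assumes "set w \<subseteq> {..<length X}"
  shows "\<eta> \<bullet> (\<Sum>i\<leftarrow>w. X ! i) = real (length w)"
  using assms by (induction w) (auto simp: inner_add_right)

lemma finite_words: "finite {w. set w \<subseteq> {..<length X} \<and> (\<Sum>i\<leftarrow>w. X ! i) = z}"
proof (rule finite_subset)
  show "{w. set w \<subseteq> {..<length X} \<and> (\<Sum>i\<leftarrow>w. X ! i) = z} \<subseteq>
      {w. set w \<subseteq> {..<length X} \<and> length w = nat \<lfloor>\<eta> \<bullet> z\<rfloor>}"
    using inner_word by auto
qed (simp add: finite_lists_length_eq)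

text \<open>Every word with sum \<open>z\<close> has weight \<open>exp (- (t \<bullet> z))\<close>
  and the same length, and all words of that length have total weight a power of
  \<open>expsum X t\<close>, hence at most 1.\<close>

lemma word_count_le_exp:
  assumes "expsum X t \<le> 1"
  shows "real (word_count X z) \<le> exp (t \<bullet> z)"
proof -
  let ?W = "{w. set w \<subseteq> {..<length X} \<and> (\<Sum>i\<leftarrow>w. X ! i) = z}"
  let ?L = "{w. set w \<subseteq> {..<length X} \<and> length w = nat \<lfloor>\<eta> \<bullet> z\<rfloor>}"
  let ?g = "\<lambda>i. exp (- (t \<bullet> X ! i))"
  have g: "prod_list (map ?g w) = exp (- (t \<bullet> (\<Sum>i\<leftarrow>w. X ! i)))" for w
    by (induction w) (auto simp: inner_add_right simp flip: exp_add)
  have "real (card ?W) * exp (- (t \<bullet> z)) = (\<Sum>w\<in>?W. prod_list (map ?g w))"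
    unfolding g by simp
  also have "\<dots> \<le> (\<Sum>w\<in>?L. prod_list (map ?g w))"
    unfolding g by (rule sum_mono2) (use inner_word in \<open>auto simp: finite_lists_length_eq\<close>)
  also have "\<dots> = expsum X t ^ nat \<lfloor>\<eta> \<bullet> z\<rfloor>"
    unfolding expsum_def by (rule sum_prod_list_words) simp
  also have "\<dots> \<le> 1"
    using assms expsum_pos[of t] by (intro power_le_one) auto
  finally show ?thesis
    by (simp add: word_count_def exp_minus field_simps)
qed

text \<open>The rearrangements of the multiset containing each index \<open>j\<close> exactly
  \<open>n j\<close> times are words with the required sum, and their number is the multinomial
  coefficient.\<close>

lemma multinomial_le_word_count:
  "fact (\<Sum>j<length X. n j) / (\<Prod>j<length X. fact (n j)) \<le>
     real (word_count X (\<Sum>j<length X. real (n j) *\<^sub>R X ! j))"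
proof -
  define A where "A = (\<Sum>j<length X. replicate_mset (n j) j)"
  have count: "count A i = (if i < length X then n i else 0)" for i
    unfolding A_def count_sum by (simp add: if_distrib cong: if_cong)
  then have set: "set_mset A \<subseteq> {..<length X}"
    by (auto simp flip: count_greater_zero_iff split: if_splits)
  have size: "size A = (\<Sum>j<length X. n j)"
    unfolding A_def by simp
  have "permutations_of_multiset A \<subseteq>
      {w. set w \<subseteq> {..<length X} \<and> (\<Sum>i\<leftarrow>w. X ! i) = (\<Sum>j<length X. real (n j) *\<^sub>R X ! j)}"
  proof
    fix w assume "w \<in> permutations_of_multiset A"
    then have w: "mset w = A" by (simp add: permutations_of_multiset_def)
    then have "(\<Sum>i\<leftarrow>w. X ! i) = (\<Sum>i\<in>#A. X ! i)"
      by (metis mset_map sum_mset_sum_list)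
    then show "w \<in> {w. set w \<subseteq> {..<length X} \<and> (\<Sum>i\<leftarrow>w. X ! i) = (\<Sum>j<length X. real (n j) *\<^sub>R X ! j)}"
      using w set unfolding A_def sum_mset_replicate_family by (metis (mono_tags) mem_Collect_eq set_mset_mset)
  qed
  then have le: "card (permutations_of_multiset A) \<le> word_count X (\<Sum>j<length X. real (n j) *\<^sub>R X ! j)"
    unfolding word_count_def by (intro card_mono finite_words)
  have "(\<Prod>j\<in>set_mset A. fact (count A j)) = (\<Prod>j<length X. fact (count A j) :: nat)"
    using set by (intro prod.mono_neutral_left) (auto simp: not_in_iff)
  also have "\<dots> = (\<Prod>j<length X. fact (n j))"
    by (simp add: count)
  finally have "card (permutations_of_multiset A) * (\<Prod>j<length X. fact (n j)) = fact (\<Sum>j<length X. n j)"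
    using card_permutations_of_multiset_aux[of A] size by simp
  then have "real (card (permutations_of_multiset A)) * (\<Prod>j<length X. fact (n j)) = fact (\<Sum>j<length X. n j)"
    by (metis (mono_tags, lifting) of_nat_fact of_nat_mult of_nat_prod prod.cong)
  moreover have "(\<Prod>j<length X. fact (n j) :: real) > 0"
    by (intro prod_pos) auto
  ultimately show ?thesis
    using le by (metis nonzero_eq_divide_eq less_irrefl of_nat_le_iff)
qed

text \<open>Integral vectors are uniformly discrete, so the semigroup is closed and nearest points
  exist; the infimum is then over a nonempty set of naturals.\<close>

lemma multiplicity_at_attained:
  obtains z where "z \<in> family_semigroup X" "norm (x - z) = infdist x (family_semigroup X)"
    "multiplicity_at X x = word_count X z"
proof -
  have "closed (family_semigroup X)"
    by (rule discrete_imp_closed[of 1])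
       (use semigroup_integral in \<open>auto intro: integral_vectors_dist_less_1_imp_eq\<close>)
  moreover have "family_semigroup X \<noteq> {}"
    unfolding family_semigroup_def by blast
  ultimately obtain z0 where "z0 \<in> family_semigroup X" "infdist x (family_semigroup X) = dist x z0"
    using infdist_attains_inf by blast
  then have "{word_count X z | z. z \<in> family_semigroup X \<and>
      norm (x - z) = infdist x (family_semigroup X)} \<noteq> {}"
    by (auto simp: dist_norm)
  from Inf_nat_def1[OF this] that show thesis
    unfolding multiplicity_at_def by blast
qed

text \<open>Rounding the cone coefficients down moves the point by at most the length of each
  member.\<close>

lemma infdist_semigroup_le:
  assumes "x \<in> family_cone X"
  shows "infdist x (family_semigroup X) \<le> (\<Sum>j<length X. norm (X ! j))"
proof -
  obtain c where c: "x = (\<Sum>j<length X. c j *\<^sub>R X ! j)" "\<forall>j<length X. 0 \<le> c j"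
    using assms unfolding family_cone_def by auto
  define z where "z = (\<Sum>j<length X. real (nat \<lfloor>c j\<rfloor>) *\<^sub>R X ! j)"
  have "infdist x (family_semigroup X) \<le> dist x z"
    by (rule infdist_le) (auto simp: z_def family_semigroup_def)
  also have "dist x z = norm (\<Sum>j<length X. (c j - real (nat \<lfloor>c j\<rfloor>)) *\<^sub>R X ! j)"
    unfolding dist_norm c(1) z_def by (simp add: sum_subtractf scaleR_diff_left)
  also have "\<dots> \<le> (\<Sum>j<length X. norm (X ! j))"
  proof (rule sum_norm_le)
    fix j assume j: "j \<in> {..<length X}"
    then have "0 \<le> c j" using c(2) by simp
    then have "\<bar>c j - real (nat \<lfloor>c j\<rfloor>)\<bar> \<le> 1"
      by (auto simp: abs_le_iff) linarith+
    then show "norm ((c j - real (nat \<lfloor>c j\<rfloor>)) *\<^sub>R X ! j) \<le> norm (X ! j)"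
      by (simp add: mult_left_le_one_le)
  qed
  finally show ?thesis .
qed

text \<open>A ball contains only finitely many integral vectors. Fixing one integer representation
  for each attained vector bounds all the coefficients at once.\<close>

lemma bounded_integer_coefficients:
  obtains M :: real where
    "\<forall>e :: nat \<Rightarrow> int. norm (\<Sum>j<length X. of_int (e j) *\<^sub>R X ! j) \<le> R \<longrightarrow>
       (\<exists>e'. (\<Sum>j<length X. of_int (e' j) *\<^sub>R X ! j) = (\<Sum>j<length X. of_int (e j) *\<^sub>R X ! j) \<and>
            (\<forall>j<length X. \<bar>of_int (e' j)\<bar> \<le> M))"
proof -
  define \<Phi> :: "(nat \<Rightarrow> int) \<Rightarrow> real^'n" where "\<Phi> e = (\<Sum>j<length X. of_int (e j) *\<^sub>R X ! j)" for e
  define S where "S = range \<Phi> \<inter> cball 0 R"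
  have "X ! j $ i \<in> \<int>" if "j < length X" for i j
    using integral that by (simp add: integral_family_def)
  then have "S \<subseteq> {v. (\<forall>i. v $ i \<in> \<int>) \<and> norm v \<le> R}"
    by (auto simp: S_def \<Phi>_def intro!: Ints_sum Ints_mult)
  then have fin: "finite S"
    using finite_bounded_integral_vectors finite_subset by blast
  have "\<forall>v\<in>S. \<exists>e. \<Phi> e = v" by (auto simp: S_def)
  then obtain E where E: "\<And>v. v \<in> S \<Longrightarrow> \<Phi> (E v) = v" by metis
  define M where "M = (\<Sum>v\<in>S. \<Sum>j<length X. \<bar>real_of_int (E v j)\<bar>)"
  show thesis
  proof (rule that[of M], fold \<Phi>_def, intro allI impI)
    fix e assume "norm (\<Phi> e) \<le> R"
    then have S: "\<Phi> e \<in> S" by (simp add: S_def)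
    have "\<bar>real_of_int (E (\<Phi> e) j)\<bar> \<le> M" if "j < length X" for j
    proof -
      have "\<bar>real_of_int (E (\<Phi> e) j)\<bar> \<le> (\<Sum>j<length X. \<bar>real_of_int (E (\<Phi> e) j)\<bar>)"
        using that by (intro member_le_sum) auto
      also have "\<dots> \<le> M"
        unfolding M_def using S fin
        by (intro member_le_sum[of _ S "\<lambda>v. \<Sum>j<length X. \<bar>real_of_int (E v j)\<bar>"]) (auto intro: sum_nonneg)
      finally show ?thesis .
    qed
    then show "\<exists>e'. \<Phi> e' = \<Phi> e \<and> (\<forall>j<length X. \<bar>real_of_int (e' j)\<bar> \<le> M)"
      using E[OF S] by blast
  qed
qed

text \<open>A nearest point and the combination with rounded coefficients
  \<open>real k * q j\<close> differ by a lattice vector of bounded norm. Representing that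
  difference with bounded integers gives coefficients of the nearest point close to
  \<open>real k * q j\<close>.\<close>

lemma nearest_point_coefficients:
  assumes q: "\<And>j. j < length X \<Longrightarrow> q j > 0"
    and \<theta>: "\<theta> = (\<Sum>j<length X. q j *\<^sub>R X ! j)"
  obtains f :: "nat \<Rightarrow> nat \<Rightarrow> nat" and C :: real where
    "\<forall>\<^sub>F k in sequentially.
       multiplicity_at X (real k *\<^sub>R \<theta>) = word_count X (\<Sum>j<length X. real (f k j) *\<^sub>R X ! j)"
    "\<forall>\<^sub>F k in sequentially. \<forall>j<length X. \<bar>real (f k j) - real k * q j\<bar> \<le> C"
proof -
  define R where "R = (\<Sum>j<length X. norm (X ! j))"
  obtain M :: real where M:
    "\<forall>e :: nat \<Rightarrow> int. norm (\<Sum>j<length X. of_int (e j) *\<^sub>R X ! j) \<le> R + R \<longrightarrow>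
       (\<exists>e'. (\<Sum>j<length X. of_int (e' j) *\<^sub>R X ! j) = (\<Sum>j<length X. of_int (e j) *\<^sub>R X ! j) \<and>
            (\<forall>j<length X. \<bar>of_int (e' j)\<bar> \<le> M))"
    using bounded_integer_coefficients[of "R + R"] .
  have ex: "\<exists>n :: nat \<Rightarrow> nat.
       multiplicity_at X (real k *\<^sub>R \<theta>) = word_count X (\<Sum>j<length X. real (n j) *\<^sub>R X ! j) \<and>
       (\<forall>j<length X. \<bar>real (n j) - real k * q j\<bar> \<le> M + 1)"
    if big: "\<forall>j<length X. real k * q j \<ge> M + 1" for k
  proof -
    have cone: "real k *\<^sub>R \<theta> \<in> family_cone X"
      unfolding \<theta> family_cone_def using q
      by (auto simp: scaleR_sum_right less_imp_le intro!: exI[of _ "\<lambda>j. real k * q j"])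
    obtain z where z: "z \<in> family_semigroup X"
      "norm (real k *\<^sub>R \<theta> - z) = infdist (real k *\<^sub>R \<theta>) (family_semigroup X)"
      "multiplicity_at X (real k *\<^sub>R \<theta>) = word_count X z"
      using multiplicity_at_attained .
    have zR: "norm (z - real k *\<^sub>R \<theta>) \<le> R"
      using infdist_semigroup_le[OF cone] z(2) by (simp add: R_def norm_minus_commute)
    obtain c :: "nat \<Rightarrow> nat" where c: "z = (\<Sum>j<length X. real (c j) *\<^sub>R X ! j)"
      using z(1) unfolding family_semigroup_def by auto
    define g where "g j = \<lfloor>real k * q j\<rfloor>" for j
    \<comment> \<open>The given coefficients \<open>c\<close> may be far from
      \<open>real k * q j\<close>; only the sum \<open>v\<close> is known to be short.\<close>
    define v where "v = (\<Sum>j<length X. of_int (int (c j) - g j) *\<^sub>R X ! j)"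
    have v: "v = (z - real k *\<^sub>R \<theta>) + (\<Sum>j<length X. (real k * q j - of_int (g j)) *\<^sub>R X ! j)"
      unfolding v_def c \<theta> by (simp add: scaleR_sum_right sum_subtractf scaleR_diff_left)
    have "norm (\<Sum>j<length X. (real k * q j - of_int (g j)) *\<^sub>R X ! j) \<le> R"
      unfolding R_def
    proof (rule sum_norm_le)
      fix j
      have "\<bar>real k * q j - of_int (g j)\<bar> \<le> 1"
        unfolding g_def abs_le_iff by linarith
      then show "norm ((real k * q j - of_int (g j)) *\<^sub>R X ! j) \<le> norm (X ! j)"
        by (simp add: mult_left_le_one_le)
    qed
    then have "norm v \<le> R + R"
      unfolding v using zR by (intro norm_triangle_le add_mono)
    then obtain e where e: "(\<Sum>j<length X. of_int (e j) *\<^sub>R X ! j) = v"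
      "\<And>j. j < length X \<Longrightarrow> \<bar>of_int (e j)\<bar> \<le> M"
      unfolding v_def using M[rule_format, of "\<lambda>j. int (c j) - g j"] by blast
    \<comment> \<open>Truncation by \<open>nat\<close> changes nothing at indices in range, since
      \<open>big\<close> makes \<open>g j + e j\<close> positive there.\<close>
    define n where "n j = nat (g j + e j)" for j
    have n: "real (n j) = of_int (g j + e j)" "\<bar>real (n j) - real k * q j\<bar> \<le> M + 1"
      if j: "j < length X" for j
    proof -
      have "real_of_int (g j + e j) > - 1 + (real k * q j - M)"
        unfolding g_def using e(2)[OF j] by (simp add: abs_le_iff) linarith
      then have "real_of_int (g j + e j) > 0"
        using big j by force
      then have "g j + e j \<ge> 0" by linarith
      then show 1: "real (n j) = of_int (g j + e j)"
        by (simp add: n_def)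
      have "\<bar>real_of_int (g j) - real k * q j\<bar> \<le> 1"
        unfolding g_def abs_le_iff by linarith
      then show "\<bar>real (n j) - real k * q j\<bar> \<le> M + 1"
        using e(2)[OF j] unfolding 1 by (simp add: abs_le_iff)
    qed
    have "(\<Sum>j<length X. real (n j) *\<^sub>R X ! j) = (\<Sum>j<length X. of_int (g j) *\<^sub>R X ! j) + v"
      unfolding e(1)[symmetric] using n(1) by (simp add: scaleR_add_left sum.distrib)
    also have "\<dots> = z"
      unfolding v_def c by (simp add: scaleR_diff_left sum_subtractf)
    finally show ?thesis
      using z(3) n(2) by metis
  qed
  have "\<forall>k. \<exists>n :: nat \<Rightarrow> nat. (\<forall>j<length X. real k * q j \<ge> M + 1) \<longrightarrow>
       multiplicity_at X (real k *\<^sub>R \<theta>) = word_count X (\<Sum>j<length X. real (n j) *\<^sub>R X ! j) \<and>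
       (\<forall>j<length X. \<bar>real (n j) - real k * q j\<bar> \<le> M + 1)"
    using ex by blast
  then obtain f where f: "\<And>k. (\<forall>j<length X. real k * q j \<ge> M + 1) \<Longrightarrow>
       multiplicity_at X (real k *\<^sub>R \<theta>) = word_count X (\<Sum>j<length X. real (f k j) *\<^sub>R X ! j) \<and>
       (\<forall>j<length X. \<bar>real (f k j) - real k * q j\<bar> \<le> M + 1)"
    by metis
  have "\<forall>\<^sub>F k in sequentially. real k * q j \<ge> M + 1" if "j < length X" for j
  proof -
    have "filterlim (\<lambda>k. real k * q j) at_top sequentially"
      using q[OF that] by real_asymp
    then show ?thesis by (simp add: filterlim_at_top)
  qed
  then have ev: "\<forall>\<^sub>F k in sequentially. \<forall>j<length X. real k * q j \<ge> M + 1"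
    using eventually_ball_finite[of "{..<length X}" "\<lambda>k j. M + 1 \<le> real k * q j" sequentially] by (simp add: Ball_def)
  show thesis
    by (rule that[of f "M + 1"]; use ev in eventually_elim) (use f in blast)+
qed

text \<open>The coefficients of the nearest points are asymptotic to \<open>k\<close> times the
  tilted weights. For these the multinomial lower bound and the exponential upper bound have the
  same rate.\<close>

lemma growth_rate_tilted_mean:
  assumes t: "expsum X t = 1" and "\<kappa> > 0" and \<theta>: "\<theta> = \<kappa> *\<^sub>R tilted_mean X t"
  shows "(\<lambda>k. ln (real (multiplicity_at X (real k *\<^sub>R \<theta>))) / real k) \<longlonglongrightarrow> t \<bullet> \<theta>"
proof -
  define q where "q j = \<kappa> * exp (- (t \<bullet> X ! j))" for j
  have q: "q j > 0" for j using \<open>\<kappa> > 0\<close> by (simp add: q_def)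
  have \<theta>q: "\<theta> = (\<Sum>j<length X. q j *\<^sub>R X ! j)"
    unfolding \<theta> tilted_mean_def q_def by (simp add: scaleR_sum_right)
  obtain f :: "nat \<Rightarrow> nat \<Rightarrow> nat" and C :: real where
    f: "\<forall>\<^sub>F k in sequentially.
       multiplicity_at X (real k *\<^sub>R \<theta>) = word_count X (\<Sum>j<length X. real (f k j) *\<^sub>R X ! j)"
    and C: "\<forall>\<^sub>F k in sequentially. \<forall>j<length X. \<bar>real (f k j) - real k * q j\<bar> \<le> C"
    using nearest_point_coefficients[of q, OF q \<theta>q] .
  have lim: "(\<lambda>k. real (f k j) / real k) \<longlonglongrightarrow> q j" if j: "j < length X" for j
  proof -
    have "(\<lambda>k. real (f k j) / real k - q j) \<longlonglongrightarrow> 0"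
    proof (rule Lim_null_comparison)
      show "\<forall>\<^sub>F k in sequentially. norm (real (f k j) / real k - q j) \<le> C / real k"
        using C eventually_gt_at_top[of 0]
      proof eventually_elim
        case (elim k)
        then have "real (f k j) / real k - q j = (real (f k j) - real k * q j) / real k"
          by (simp add: field_simps)
        then show ?case using elim j by (simp add: abs_divide divide_right_mono)
      qed
      show "(\<lambda>k. C / real k) \<longlonglongrightarrow> 0" by real_asymp
    qed
    then show ?thesis by (simp add: LIM_zero_iff)
  qed
  have qsum: "(\<Sum>j<length X. q j) = \<kappa>"
    using t unfolding q_def expsum_def by (simp flip: sum_distrib_left)
  have t\<theta>: "t \<bullet> \<theta> = (\<Sum>j<length X. q j * (t \<bullet> X ! j))"
    unfolding \<theta>q by (simp add: inner_sum_right)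
  define N where "N k = (\<Sum>j<length X. f k j)" for k
  have "(\<lambda>k. \<Sum>j<length X. real (f k j) / real k) \<longlonglongrightarrow> (\<Sum>j<length X. q j)"
    by (intro tendsto_sum lim) auto
  then have limN: "(\<lambda>k. real (N k) / real k) \<longlonglongrightarrow> \<kappa>"
    unfolding qsum N_def by (simp add: sum_divide_distrib)
  define lo where "lo k = (ln (fact (N k)) - (\<Sum>j<length X. ln (fact (f k j)))) / real k" for k
  define up where "up k = (\<Sum>j<length X. real (f k j) / real k * (t \<bullet> X ! j))" for k
  have "up \<longlonglongrightarrow> t \<bullet> \<theta>"
    unfolding up_def t\<theta> by (intro tendsto_intros lim) auto
  moreover have "lo \<longlonglongrightarrow> t \<bullet> \<theta>"
  proof -
    \<comment> \<open>The corrections by \<open>ln k\<close> cancel because \<open>N k\<close> is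
      the sum of the \<open>f k j\<close>.\<close>
    have "(\<lambda>k. (ln (fact (N k)) - real (N k) * ln k) / real k
          - (\<Sum>j<length X. (ln (fact (f k j)) - real (f k j) * ln k) / real k))
        \<longlonglongrightarrow> (\<kappa> * ln \<kappa> - \<kappa>) - (\<Sum>j<length X. q j * ln (q j) - q j)"
      by (intro tendsto_diff tendsto_sum ln_fact_asymptotics lim limN \<open>\<kappa> > 0\<close> q) auto
    moreover have "(ln (fact (N k)) - real (N k) * ln k) / real k
          - (\<Sum>j<length X. (ln (fact (f k j)) - real (f k j) * ln k) / real k) = lo k" for k
      unfolding lo_def N_def
      by (simp add: sum_divide_distrib[symmetric] sum_subtractf sum_distrib_right diff_divide_distrib)
    \<comment> \<open>The entropy of the tilted weights: \<open>ln (q j)\<close> is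
      \<open>ln \<kappa>\<close> minus the pairing of \<open>t\<close> with the member, and the
      weights add up to \<open>\<kappa>\<close>.\<close>
    moreover have "(\<kappa> * ln \<kappa> - \<kappa>) - (\<Sum>j<length X. q j * ln (q j) - q j) = t \<bullet> \<theta>"
    proof -
      have "ln (q j) = ln \<kappa> - t \<bullet> X ! j" for j
        using \<open>\<kappa> > 0\<close> by (simp add: q_def ln_mult)
      then have "(\<Sum>j<length X. q j * ln (q j) - q j) = (\<Sum>j<length X. q j) * ln \<kappa> - t \<bullet> \<theta> - (\<Sum>j<length X. q j)"
        by (simp add: t\<theta> right_diff_distrib sum_subtractf sum_distrib_right)
      then show ?thesis by (simp add: qsum)
    qed
    ultimately show ?thesis by simp
  qed
  moreover have "\<forall>\<^sub>F k in sequentially. lo k \<le> ln (real (multiplicity_at X (real k *\<^sub>R \<theta>))) / real k \<and>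
      ln (real (multiplicity_at X (real k *\<^sub>R \<theta>))) / real k \<le> up k"
      (is "\<forall>\<^sub>F k in _. lo k \<le> ?r k \<and> _")
    using f
  proof eventually_elim
    case (elim k)
    let ?z = "\<Sum>j<length X. real (f k j) *\<^sub>R X ! j"
    let ?mult = "fact (N k) / (\<Prod>j<length X. fact (f k j)) :: real"
    have "(\<Prod>j<length X. fact (f k j) :: real) > 0"
      by (intro prod_pos) auto
    then have pos: "?mult > 0" by simp
    have le: "?mult \<le> real (word_count X ?z)"
      unfolding N_def by (rule multinomial_le_word_count)
    have "ln ?mult \<le> ln (real (word_count X ?z))"
      using pos le by (meson ln_mono)
    moreover have "ln ?mult = ln (fact (N k)) - (\<Sum>j<length X. ln (fact (f k j)))"
      using pos by (simp add: ln_div ln_prod)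
    ultimately have 1: "lo k \<le> ln (real (word_count X ?z)) / real k"
      unfolding lo_def by (simp add: divide_right_mono)
    have "ln (real (word_count X ?z)) \<le> ln (exp (t \<bullet> ?z))"
      using word_count_le_exp[of t ?z] t pos le by (intro ln_mono) auto
    then have "ln (real (word_count X ?z)) / real k \<le> (t \<bullet> ?z) / real k"
      by (simp add: divide_right_mono)
    also have "\<dots> = up k"
      unfolding up_def by (simp add: inner_sum_right sum_divide_distrib)
    finally show ?case using 1 elim by simp
  qed
  ultimately show ?thesis
    using tendsto_sandwich[of lo ?r sequentially up] by (simp add: eventually_conj_iff)
qed

lemma directional_growth_tilted_mean:
  assumes "expsum X t = 1" and "\<kappa> > 0" and "\<theta> = \<kappa> *\<^sub>R tilted_mean X t"
  shows "directional_growth X \<theta> = t \<bullet> \<theta>"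
  unfolding directional_growth_def by (rule limI[OF growth_rate_tilted_mean[OF assms]])

text \<open>A Lagrange multiplier argument: \<open>t\<close> minimises the pairing with
  \<open>\<theta>\<close> on the convex set \<open>expsum X \<le> 1\<close>. Positivity of all
  coefficients supplies compactness.\<close>

lemma exists_tilting:
  assumes c: "\<And>j. j < length X \<Longrightarrow> c j > 0" and \<theta>: "\<theta> = (\<Sum>j<length X. c j *\<^sub>R X ! j)"
  obtains t \<kappa> where "\<kappa> > 0" "expsum X t = 1" "\<theta> = \<kappa> *\<^sub>R tilted_mean X t"
proof -
  define K where "K = {t. expsum X t \<le> 1}"
  have \<eta>\<theta>: "\<eta> \<bullet> \<theta> = (\<Sum>j<length X. c j)"
    unfolding \<theta> by (simp add: inner_sum_right)
  have csum: "(\<Sum>j<length X. c j) > 0"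
    using nonempty c by (intro sum_pos) auto
  have K_pos: "0 \<le> t \<bullet> X ! j" if "t \<in> K" "j < length X" for t j
  proof -
    have "exp (- (t \<bullet> X ! j)) \<le> expsum X t"
      unfolding expsum_def using that by (intro member_le_sum[of j]) auto
    also have "\<dots> \<le> 1" using that by (simp add: K_def)
    finally show ?thesis by simp
  qed
  \<comment> \<open>The shift of 0 along \<open>\<eta>\<close> onto the hypersurface, giving a
    reference point of \<open>K\<close>.\<close>
  define t0 where "t0 = ln (expsum X 0) *\<^sub>R \<eta>"
  have t0: "t0 \<in> K"
    using expsum_shift[of 0 "ln (expsum X 0)"] expsum_pos[of 0] by (simp add: K_def t0_def exp_minus)
  define S where "S = K \<inter> {t. t \<bullet> \<theta> \<le> t0 \<bullet> \<theta>}"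
  \<comment> \<open>On \<open>K\<close> all pairings with members are nonnegative, so a bound on
    \<open>t \<bullet> \<theta>\<close> bounds each of them; spanning extends this to every
    vector.\<close>
  have bd: "\<exists>B. \<forall>t\<in>S. \<bar>t \<bullet> x\<bar> \<le> B" for x
  proof -
    have "x \<in> span (set X)" using spanning by simp
    then show ?thesis
    proof (induction rule: span_induct_alt)
      case base
      then show ?case by auto
    next
      case (step a v x)
      obtain j where j: "j < length X" "v = X ! j" using step by (metis in_set_conv_nth)
      have B1: "\<bar>t \<bullet> v\<bar> \<le> (t0 \<bullet> \<theta>) / c j" if "t \<in> S" for t
      proof -
        have K: "t \<in> K" using that by (simp add: S_def)
        have "c j * (t \<bullet> v) \<le> (\<Sum>i<length X. c i * (t \<bullet> X ! i))"
          unfolding j(2) using c K_pos[OF K] j(1)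
          by (intro member_le_sum[of j _ "\<lambda>i. c i * (t \<bullet> X ! i)"]) (auto simp: less_imp_le)
        also have "\<dots> = t \<bullet> \<theta>" unfolding \<theta> by (simp add: inner_sum_right)
        also have "\<dots> \<le> t0 \<bullet> \<theta>" using that by (simp add: S_def)
        finally show ?thesis
          using K_pos[OF K j(1)] c[OF j(1)] j(2) by (simp add: field_simps)
      qed
      obtain B where B: "\<forall>t\<in>S. \<bar>t \<bullet> x\<bar> \<le> B" using step by blast
      have "\<bar>t \<bullet> (a *\<^sub>R v + x)\<bar> \<le> \<bar>a\<bar> * ((t0 \<bullet> \<theta>) / c j) + B" if "t \<in> S" for t
      proof -
        have "\<bar>t \<bullet> (a *\<^sub>R v + x)\<bar> \<le> \<bar>a\<bar> * \<bar>t \<bullet> v\<bar> + \<bar>t \<bullet> x\<bar>"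
          by (simp add: inner_add_right abs_triangle_ineq flip: abs_mult)
        also have "\<dots> \<le> \<bar>a\<bar> * ((t0 \<bullet> \<theta>) / c j) + B"
          using B1[OF that] B that by (intro add_mono mult_left_mono) auto
        finally show ?thesis .
      qed
      then show ?case by blast
    qed
  qed
  have "\<forall>i. \<exists>B. \<forall>t\<in>S. \<bar>t \<bullet> axis i 1\<bar> \<le> B" using bd by blast
  then obtain B where B: "\<And>i t. t \<in> S \<Longrightarrow> \<bar>t $ i\<bar> \<le> B i"
    unfolding inner_axis by simp metis
  have "bounded S"
    unfolding bounded_iff
  proof (intro exI ballI)
    fix t assume "t \<in> S"
    then show "norm t \<le> (\<Sum>i\<in>UNIV. B i)"
      using norm_le_l1_cart[of t] B by (meson order_trans sum_mono)
  qed
  moreover have "closed S"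
    unfolding S_def K_def
    by (intro closed_Int closed_Collect_le continuous_intros)
  ultimately have "compact S" by (simp add: compact_eq_bounded_closed)
  moreover have "S \<noteq> {}" using t0 by (auto simp: S_def)
  ultimately obtain t where t: "t \<in> S" "\<And>s. s \<in> S \<Longrightarrow> t \<bullet> \<theta> \<le> s \<bullet> \<theta>"
    using continuous_attains_inf[of S "\<lambda>t. t \<bullet> \<theta>"] continuous_on_inner[OF continuous_on_id continuous_on_const]
    by blast
  have tK: "t \<in> K" using t(1) by (simp add: S_def)
  have min: "t \<bullet> \<theta> \<le> s \<bullet> \<theta>" if "s \<in> K" for s
    using t that unfolding S_def by (cases "s \<bullet> \<theta> \<le> t0 \<bullet> \<theta>") auto
  have t1: "expsum X t = 1"
  proof (rule ccontr)
    assume "expsum X t \<noteq> 1"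
    then have less: "expsum X t < 1" using tK by (simp add: K_def)
    \<comment> \<open>Moving back along \<open>\<eta>\<close> to the hypersurface stays in
      \<open>K\<close> and would lower the minimum.\<close>
    have "t + ln (expsum X t) *\<^sub>R \<eta> \<in> K"
      using expsum_shift[of t "ln (expsum X t)"] expsum_pos[of t] by (simp add: K_def exp_minus)
    from min[OF this] have "0 \<le> ln (expsum X t) * (\<Sum>j<length X. c j)"
      by (simp add: inner_add_left \<eta>\<theta>)
    moreover have "ln (expsum X t) < 0" using less expsum_pos by simp
    ultimately show False using csum by (simp add: zero_le_mult_iff)
  qed
  define \<mu> where "\<mu> = tilted_mean X t"
  \<comment> \<open>A direction that lowers the pairing with \<open>\<theta>\<close> cannot lower
    \<open>expsum X\<close> to first order at the minimiser.\<close>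
  have halfspace: "v \<bullet> \<mu> \<le> 0" if v: "v \<bullet> \<theta> < 0" for v
  proof (rule ccontr)
    assume "\<not> v \<bullet> \<mu> \<le> 0"
    then have "- (v \<bullet> tilted_mean X t) < 0" by (simp add: \<mu>_def)
    from DERIV_neg_dec_right[OF expsum_has_derivative_along_line this]
    obtain d where d: "d > 0" "\<forall>h>0. h < d \<longrightarrow> expsum X (t + h *\<^sub>R v) < expsum X t"
      by auto
    then have "t + (d / 2) *\<^sub>R v \<in> K" using t1 by (auto simp: K_def less_imp_le)
    from min[OF this] have "0 \<le> d / 2 * (v \<bullet> \<theta>)" by (simp add: inner_add_left)
    then show False using d(1) v by (simp add: zero_le_mult_iff)
  qed
  have \<theta>0: "\<theta> \<noteq> 0" using \<eta>\<theta> csum by auto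
  define \<nu> where "\<nu> = (\<mu> \<bullet> \<theta>) / (\<theta> \<bullet> \<theta>)"
  define w where "w = \<mu> - \<nu> *\<^sub>R \<theta>"
  have w\<theta>: "w \<bullet> \<theta> = 0"
    using \<theta>0 by (simp add: w_def \<nu>_def inner_diff_left)
  have ww: "w \<bullet> \<mu> = w \<bullet> w"
    using w\<theta> by (simp add: w_def inner_diff_right)
  \<comment> \<open>\<open>w\<close> is the component of \<open>\<mu>\<close> orthogonal to
    \<open>\<theta>\<close>. Tilting it slightly towards \<open>- \<theta>\<close> makes
    \<open>halfspace\<close> applicable, and the tilt can be arbitrarily small.\<close>
  have "w \<bullet> w \<le> 0 + e" if "e > 0" for e
  proof -
    define \<delta> where "\<delta> = e / (\<bar>\<theta> \<bullet> \<mu>\<bar> + 1)"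
    have \<delta>: "\<delta> > 0" using that by (simp add: \<delta>_def)
    have "(w - \<delta> *\<^sub>R \<theta>) \<bullet> \<theta> < 0"
      using \<delta> \<theta>0 by (simp add: inner_diff_left w\<theta>)
    from halfspace[OF this] have "w \<bullet> w \<le> \<delta> * (\<theta> \<bullet> \<mu>)"
      by (simp add: inner_diff_left ww)
    also have "\<dots> \<le> \<delta> * (\<bar>\<theta> \<bullet> \<mu>\<bar> + 1)" using \<delta> by (intro mult_left_mono) auto
    also have "\<dots> = e" by (simp add: \<delta>_def)
    finally show ?thesis by simp
  qed
  then have "w \<bullet> w \<le> 0" by (rule field_le_epsilon)
  then have "w = 0" by (metis inner_eq_zero_iff inner_ge_zero order_antisym)
  then have \<mu>\<theta>: "\<mu> = \<nu> *\<^sub>R \<theta>" by (simp add: w_def)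
  have "\<nu> * (\<Sum>j<length X. c j) = 1"
    using inner_tilted_mean[of t] t1 \<eta>\<theta> \<mu>\<theta> by (simp flip: \<mu>_def)
  then have "\<nu> > 0" using csum by (metis zero_less_mult_pos2 zero_less_one)
  then show thesis
    by (intro that[of "1 / \<nu>" t]) (use t1 \<mu>\<theta> in \<open>auto simp: \<mu>_def\<close>)
qed

end

text \<open>A small multiple of the sum \<open>\<sigma>\<close> of all members of \<open>X\<close>
  can be subtracted from \<open>\<theta>\<close> without leaving the cone. Expanding the rest in
  \<open>X\<close> and adding the multiple back makes every coefficient positive.\<close>

lemma positive_combination_transfer:
  assumes cone: "family_cone X = family_cone Y"
    and c: "\<And>j. j < length Y \<Longrightarrow> c j > 0" and \<theta>: "\<theta> = (\<Sum>j<length Y. c j *\<^sub>R Y ! j)"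
  obtains d where "\<And>j. j < length X \<Longrightarrow> d j > 0" "\<theta> = (\<Sum>j<length X. d j *\<^sub>R X ! j)"
proof -
  define \<sigma> where "\<sigma> = (\<Sum>j<length X. X ! j)"
  have "\<sigma> \<in> family_cone X"
    unfolding family_cone_def \<sigma>_def by (auto intro!: exI[of _ "\<lambda>_. 1"])
  then have "\<sigma> \<in> family_cone Y" using cone by simp
  then obtain s where s: "\<sigma> = (\<Sum>j<length Y. s j *\<^sub>R Y ! j)" "\<forall>j<length Y. s j \<ge> 0"
    unfolding family_cone_def by auto
  \<comment> \<open>Large enough that \<open>s j / M \<le> c j\<close> for all \<open>j\<close>; the
    summand 1 keeps it positive.\<close>
  define M where "M = 1 + (\<Sum>j<length Y. s j / c j)"
  have "(\<Sum>j<length Y. s j / c j) \<ge> 0"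
    using c s(2) by (intro sum_nonneg) (auto simp: less_imp_le)
  then have M: "M > 0" by (simp add: M_def)
  have le: "s j / M \<le> c j" if "j < length Y" for j
  proof -
    have "s j / c j \<le> (\<Sum>j<length Y. s j / c j)"
      using that c s(2) by (intro member_le_sum) (auto simp: less_imp_le)
    then have "s j / c j \<le> M" by (simp add: M_def)
    then show ?thesis using M c[OF that] by (simp add: field_simps)
  qed
  have "\<theta> - (1 / M) *\<^sub>R \<sigma> = (\<Sum>j<length Y. (c j - s j / M) *\<^sub>R Y ! j)"
    unfolding \<theta> s(1) by (simp add: scaleR_sum_right scaleR_diff_left sum_subtractf)
  then have "\<theta> - (1 / M) *\<^sub>R \<sigma> \<in> family_cone Y"
    unfolding family_cone_def using le by auto
  then have "\<theta> - (1 / M) *\<^sub>R \<sigma> \<in> family_cone X" using cone by simp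
  then obtain e where e: "\<theta> - (1 / M) *\<^sub>R \<sigma> = (\<Sum>j<length X. e j *\<^sub>R X ! j)" "\<forall>j<length X. e j \<ge> 0"
    unfolding family_cone_def by auto
  have "\<theta> = (\<Sum>j<length X. e j *\<^sub>R X ! j) + (1 / M) *\<^sub>R \<sigma>"
    using e(1) by (simp add: algebra_simps)
  also have "\<dots> = (\<Sum>j<length X. (e j + 1 / M) *\<^sub>R X ! j)"
    unfolding \<sigma>_def by (simp add: scaleR_sum_right scaleR_add_left sum.distrib)
  finally show thesis
    using that[of "\<lambda>j. e j + 1 / M"] e(2) M by (simp add: add_nonneg_pos)
qed

text \<open>A point outside the convex set \<open>expsum Y \<le> 1\<close> is separated from it by a
  tangent hyperplane. In the normal direction the growth of \<open>Y\<close> exceeds the pairing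
  with \<open>t\<close>, whereas the growth of \<open>X\<close> is at most that pairing.\<close>

lemma same_growth_expsum_le_1:
  assumes "coplanar_lattice_family X \<eta>" "coplanar_lattice_family Y \<eta>'"
    and same: "same_directional_growth X Y" and t: "expsum X t \<le> 1"
  shows "expsum Y t \<le> 1"
proof (rule ccontr)
  interpret X: coplanar_lattice_family X \<eta> by fact
  interpret Y: coplanar_lattice_family Y \<eta>' by fact
  assume "\<not> expsum Y t \<le> 1"
  \<comment> \<open>The extra 1 in the shift puts \<open>t0\<close> strictly inside, with value
    \<open>exp (- 1)\<close>.\<close>
  define t0 where "t0 = (ln (expsum Y 0) + 1) *\<^sub>R \<eta>'"
  have "expsum Y t0 = exp (- 1)"
    using Y.expsum_shift[of 0 "ln (expsum Y 0) + 1"] Y.expsum_pos[of 0]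
    by (simp add: t0_def exp_diff exp_minus inverse_eq_divide)
  then have t0: "expsum Y t0 < 1" by simp
  define h where "h a = expsum Y (t0 + a *\<^sub>R (t - t0))" for a
  have "\<exists>a\<ge>0. a \<le> 1 \<and> h a = 1"
    using t0 \<open>\<not> expsum Y t \<le> 1\<close> unfolding h_def
    by (intro IVT' continuous_intros) (auto simp: less_imp_le)
  then obtain a where a: "0 \<le> a" "a \<le> 1" "h a = 1" by blast
  define s where "s = t0 + a *\<^sub>R (t - t0)"
  have s1: "expsum Y s = 1" using a(3) by (simp add: s_def h_def)
  have a': "a > 0" "a < 1"
    using a t0 \<open>\<not> expsum Y t \<le> 1\<close> unfolding h_def by (auto simp: less_le)
  define \<mu> where "\<mu> = tilted_mean Y s"
  have "\<mu> \<noteq> 0" using Y.inner_tilted_mean[of s] s1 by (auto simp: \<mu>_def)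
  \<comment> \<open>The tangent inequality puts \<open>t0\<close> strictly on the positive side of
    the tangent hyperplane at \<open>s\<close>. As \<open>s\<close> lies between \<open>t0\<close>
    and \<open>t\<close>, the point \<open>t\<close> is strictly on the negative side.\<close>
  have "(t0 - s) \<bullet> \<mu> > 0"
    using expsum_tangent[of Y s t0] s1 t0 by (simp add: \<mu>_def)
  moreover have "t0 - s = - (a / (1 - a)) *\<^sub>R (t - s)"
  proof -
    have "(1 - a) *\<^sub>R (t0 - s) = - a *\<^sub>R (t - s)"
      by (simp add: s_def algebra_simps)
    then have "(1 / (1 - a)) *\<^sub>R ((1 - a) *\<^sub>R (t0 - s)) = (1 / (1 - a)) *\<^sub>R (- a *\<^sub>R (t - s))"
      by simp
    then show ?thesis using a' by simp
  qed
  ultimately have "(a / (1 - a)) * ((t - s) \<bullet> \<mu>) < 0" by simp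
  then have neg: "(t - s) \<bullet> \<mu> < 0"
    using a' by (simp add: divide_less_0_iff mult_less_0_iff)
  define \<theta> where "\<theta> = (1 / norm \<mu>) *\<^sub>R \<mu>"
  have unit: "norm \<theta> = 1" using \<open>\<mu> \<noteq> 0\<close> by (simp add: \<theta>_def)
  have \<theta>Y: "\<theta> = (\<Sum>j<length Y. (exp (- (s \<bullet> Y ! j)) / norm \<mu>) *\<^sub>R Y ! j)"
    unfolding \<theta>_def by (subst \<mu>_def) (simp add: tilted_mean_def scaleR_sum_right)
  have cone: "family_cone X = family_cone Y"
    using same by (simp add: same_directional_growth_def)
  obtain d where d: "\<And>j. j < length X \<Longrightarrow> d j > 0" "\<theta> = (\<Sum>j<length X. d j *\<^sub>R X ! j)"
    by (rule positive_combination_transfer[OF cone _ \<theta>Y]) (use \<open>\<mu> \<noteq> 0\<close> in auto)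
  obtain r \<kappa> where r: "\<kappa> > 0" "expsum X r = 1" "\<theta> = \<kappa> *\<^sub>R tilted_mean X r"
    using X.exists_tilting[of d, OF d] .
  have "\<theta> \<in> family_cone X"
    using d unfolding family_cone_def by (auto simp: less_imp_le)
  then have "directional_growth X \<theta> = directional_growth Y \<theta>"
    using same unit by (simp add: same_directional_growth_def)
  moreover have "directional_growth X \<theta> = r \<bullet> \<theta>"
    by (rule X.directional_growth_tilted_mean[OF r(2,1,3)])
  moreover have "directional_growth Y \<theta> = s \<bullet> \<theta>"
    using \<open>\<mu> \<noteq> 0\<close> by (intro Y.directional_growth_tilted_mean[OF s1, of "1 / norm \<mu>"]) (auto simp: \<theta>_def \<mu>_def)
  ultimately have "r \<bullet> \<theta> = s \<bullet> \<theta>" by simp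
  \<comment> \<open>By the tangent inequality at \<open>r\<close>, whose normal is proportional to
    \<open>\<theta>\<close>, the point \<open>r\<close> minimises the pairing with
    \<open>\<theta>\<close> on \<open>expsum X \<le> 1\<close>.\<close>
  moreover have "r \<bullet> \<theta> \<le> t \<bullet> \<theta>"
  proof -
    have "0 \<le> (t - r) \<bullet> tilted_mean X r"
      using expsum_tangent[of X r t] r(2) t by simp
    then show ?thesis
      unfolding r(3) using r(1) by (simp add: inner_diff_left mult_left_mono)
  qed
  ultimately have "0 \<le> (t - s) \<bullet> \<theta>" by (simp add: inner_diff_left)
  then have "0 \<le> (t - s) \<bullet> \<mu>"
    using \<open>\<mu> \<noteq> 0\<close> by (simp add: \<theta>_def zero_le_divide_iff)
  with neg show False by simp
qed

lemma same_directional_growth_sym: "same_directional_growth X Y \<Longrightarrow> same_directional_growth Y X"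
  by (auto simp: same_directional_growth_def)

text \<open>By symmetry the two sublevel sets coincide. If \<open>expsum Y t\<close> were below 1, a
  small step against \<open>\<eta>\<close> would stay in the sublevel set of \<open>Y\<close>,
  although it raises \<open>expsum X\<close> above 1.\<close>

lemma same_growth_expsum_eq_1:
  assumes X: "coplanar_lattice_family X \<eta>" and Y: "coplanar_lattice_family Y \<eta>'"
    and same: "same_directional_growth X Y" and t: "expsum X t = 1"
  shows "expsum Y t = 1"
proof (rule ccontr)
  interpret X: coplanar_lattice_family X \<eta> by fact
  assume "expsum Y t \<noteq> 1"
  then have "expsum Y t < 1"
    using same_growth_expsum_le_1[OF X Y same, of t] t by simp
  moreover have "((\<lambda>e. expsum Y (t - e *\<^sub>R \<eta>)) \<longlongrightarrow> expsum Y (t - 0 *\<^sub>R \<eta>)) (at_right 0)"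
    unfolding expsum_def by (intro tendsto_intros)
  ultimately have "\<forall>\<^sub>F e in at_right 0. expsum Y (t - e *\<^sub>R \<eta>) < 1"
    by (simp add: order_tendstoD(2))
  with eventually_at_right_less[of 0]
  have "\<forall>\<^sub>F e in at_right 0. 0 < e \<and> expsum Y (t - e *\<^sub>R \<eta>) < 1"
    by (rule eventually_conj)
  then obtain e where e: "e > 0" "expsum Y (t - e *\<^sub>R \<eta>) < 1"
    using eventually_happens' trivial_limit_at_right_real by blast
  then have "expsum X (t + (- e) *\<^sub>R \<eta>) \<le> 1"
    using same_growth_expsum_le_1[OF Y X same_directional_growth_sym[OF same], of "t - e *\<^sub>R \<eta>"] by simp
  then have "exp e \<le> 1"
    unfolding X.expsum_shift t by simp
  then show False using e(1) by simp
qed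

section \<open>Comparison of two families\<close>

context coplanar_lattice_family
begin

text \<open>A basis chosen from the members gives an invertible integer system
  \<open>A *v \<eta> = 1\<close>; Cramer's rule then makes the coordinates quotients of rational
  determinants.\<close>

lemma normal_rational: "\<eta> $ k \<in> \<rat>"
proof -
  obtain B where B: "B \<subseteq> set X" "independent B" "set X \<subseteq> span B" "card B = dim (set X)"
    using basis_exists .
  have "dim (set X) = CARD('n)"
    by (metis dim_span spanning dim_UNIV DIM_cart DIM_real mult.right_neutral)
  then have "card B = card (UNIV :: 'n set)" using B(4) by simp
  moreover have "finite B" using B(1) finite_subset by blast
  ultimately obtain h :: "'n \<Rightarrow> real^'n" where h: "bij_betw h UNIV B"
    by (metis finite_same_card_bij finite_class.finite_UNIV)
  then have hX: "h i \<in> set X" for i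
    using B(1) by (auto simp: bij_betw_def)
  define A :: "real^'n^'n" where "A = (\<chi> i. h i)"
  have "x = 0" if "A *v x = 0" for x
  proof -
    have "h i \<bullet> x = 0" for i
      using arg_cong[OF that, of "\<lambda>v. v $ i"] by (simp add: A_def matrix_vector_mul_component)
    then have "v \<bullet> x = 0" if "v \<in> B" for v
      using h that by (auto simp: bij_betw_def)
    then have "B \<subseteq> {v. v \<bullet> x = 0}" by blast
    moreover have "subspace {v. v \<bullet> x = 0}"
      by (simp add: subspace_def inner_add_left)
    ultimately have "span B \<subseteq> {v. v \<bullet> x = 0}" by (rule span_minimal)
    moreover have "span B = UNIV"
      using span_mono[OF B(3)] spanning by (auto simp: span_span)
    ultimately have "x \<bullet> x = 0" by blast
    then show ?thesis by simp
  qed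
  then have "det A \<noteq> 0"
    by (metis matrix_left_invertible_ker invertible_left_inverse invertible_det_nz)
  moreover have "A *v \<eta> = (\<chi> i. 1)"
    using coplanar hX
    by (simp add: vec_eq_iff A_def matrix_vector_mul_component coplanar_family_def inner_commute[of _ \<eta>])
  ultimately have "\<eta> = (\<chi> k. det (\<chi> i j. if j = k then (\<chi> i. 1) $ i else A $ i $ j) / det A)"
    using cramer[of A \<eta> "\<chi> i. 1"] by blast
  then have "\<eta> $ k = det (\<chi> i j. if j = k then 1 else A $ i $ j) / det A"
    by (metis (mono_tags, lifting) vec_lambda_beta vec_lambda_unique)
  moreover have "A $ i $ j \<in> \<rat>" for i j
    using integral hX[of i] unfolding A_def integral_family_def
    by (metis Ints_subset_Rats subsetD vec_lambda_beta)
  then have "det A \<in> \<rat>" "det (\<chi> i j. if j = k then 1 else A $ i $ j) \<in> \<rat>"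
    by (auto intro!: det_Rats)
  ultimately show ?thesis by simp
qed

end

lemma rational_inner_integral:
  fixes u v :: "real^'n"
  assumes "\<And>k. u $ k \<in> \<rat>" "\<And>k. v $ k \<in> \<int>"
  shows "u \<bullet> v \<in> \<rat>"
  unfolding inner_vec_def using assms Ints_subset_Rats by (auto intro!: Rats_sum Rats_mult)

text \<open>The pairings of \<open>\<eta>'\<close> with the members of \<open>X\<close> turn out to
  be all equal, so \<open>\<eta>'\<close> and a multiple of \<open>\<eta>\<close> agree on a
  spanning set.\<close>

lemma same_growth_parallel_normals:
  assumes X: "coplanar_lattice_family X \<eta>" and Y: "coplanar_lattice_family Y \<eta>'"
    and same: "same_directional_growth X Y"
  obtains c where "c > 0" "c \<in> \<rat>" "\<eta> = c *\<^sub>R \<eta>'"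
proof -
  interpret X: coplanar_lattice_family X \<eta> by fact
  interpret Y: coplanar_lattice_family Y \<eta>' by fact
  have cone: "family_cone X = family_cone Y"
    using same by (simp add: same_directional_growth_def)
  define a where "a i = \<eta>' \<bullet> X ! i" for i
  define b where "b j = \<eta> \<bullet> Y ! j" for j
  have a_pos: "a i > 0" if "i < length X" for i
    unfolding a_def using that X.member_cone X.member_nonzero cone by (intro Y.inner_cone_pos) auto
  have b_pos: "b j > 0" if "j < length Y" for j
    unfolding b_def using that Y.member_cone Y.member_nonzero cone by (intro X.inner_cone_pos) auto
  have a_rat: "a i \<in> \<rat>" if "i < length X" for i
    unfolding a_def using that X.integral
    by (intro rational_inner_integral Y.normal_rational) (simp add: integral_family_def)
  have b_rat: "b j \<in> \<rat>" if "j < length Y" for j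
    unfolding b_def using that Y.integral
    by (intro rational_inner_integral X.normal_rational) (simp add: integral_family_def)
  \<comment> \<open>Along the line \<open>\<real>\<eta>'\<close> the exponential sum of \<open>Y\<close> is a monomial; projecting that line along \<open>\<eta>\<close>
      to the common hypersurface makes the power sums of \<open>a\<close> and \<open>b\<close> mutually inverse.\<close>
  have id: "(\<Sum>j<length Y. (\<Sum>i<length X. y powr a i) powr (- b j)) = 1 / y" if y: "y > 0" for y
  proof -
    define u where "u = (- ln y) *\<^sub>R \<eta>'"
    define t where "t = u + ln (expsum X u) *\<^sub>R \<eta>"
    have p: "expsum X u = (\<Sum>i<length X. y powr a i)"
      unfolding expsum_def u_def a_def powr_def using y by (simp add: mult.commute)
    have p_pos: "expsum X u > 0" by (rule X.expsum_pos)
    have "expsum X t = 1"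
      unfolding t_def X.expsum_shift using p_pos by (simp add: exp_minus)
    then have "expsum Y t = 1"
      by (rule same_growth_expsum_eq_1[OF X Y same])
    moreover have "exp (- (t \<bullet> Y ! j)) = y * expsum X u powr (- b j)" if "j < length Y" for j
    proof -
      have "- (t \<bullet> Y ! j) = ln y + - b j * ln (expsum X u)"
        using that by (simp add: t_def u_def b_def inner_add_left inner_diff_left)
      then show ?thesis
        using y p_pos by (simp only: exp_add exp_ln powr_def) simp
    qed
    ultimately have "y * (\<Sum>j<length Y. expsum X u powr (- b j)) = 1"
      unfolding expsum_def[of Y] by (simp add: sum_distrib_left)
    then show ?thesis
      unfolding p using y by (simp add: field_simps)
  qed
  have len: "0 < length X" "0 < length Y"
    using X.nonempty Y.nonempty by auto
  have eq: "a i = a 0" if "i < length X" for i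
    using inverse_power_sums_imp_equal_exponents[OF a_pos a_rat b_pos b_rat id that len(1)] .
  have "\<eta>' = a 0 *\<^sub>R \<eta>"
    unfolding X.eq_iff_inner_members using eq by (simp add: a_def)
  then have \<eta>: "\<eta> = (1 / a 0) *\<^sub>R \<eta>'"
    using a_pos[OF len(1)] by simp
  then have "b 0 = 1 / a 0"
    using len by (simp add: b_def)
  then show thesis
    using that[of "1 / a 0"] \<eta> a_pos[OF len(1)] b_rat[OF len(2)] by simp
qed

section \<open>Iterations, and recovery of a family from its exponential sum\<close>

lemma expsum_eq_sum_list: "expsum X t = (\<Sum>v\<leftarrow>X. exp (- (t \<bullet> v)))"
  by (simp add: expsum_def sum_list_sum_nth atLeast0LessThan)

lemma sum_list_map_concat:
  "sum_list (map f (concat xss)) = (\<Sum>xs\<leftarrow>xss. sum_list (map f xs))"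
  by (induction xss) auto

text \<open>The exponential turns sums of members into products, so summing over all positional
  tuples multiplies out a power.\<close>

lemma expsum_family_iteration: "expsum (family_iteration n X) t = expsum X t ^ n"
proof -
  have "(\<Sum>w\<leftarrow>List.n_lists n X. exp (- (t \<bullet> sum_list w))) = (\<Sum>v\<leftarrow>X. exp (- (t \<bullet> v))) ^ n"
  proof (induction n)
    case (Suc n)
    have *: "exp (- (t \<bullet> (v + w))) = exp (- (t \<bullet> w)) * exp (- (t \<bullet> v))" for v w
      by (simp add: inner_add_right flip: exp_add)
    have "(\<Sum>w\<leftarrow>List.n_lists (Suc n) X. exp (- (t \<bullet> sum_list w))) =
        (\<Sum>w\<leftarrow>List.n_lists n X. exp (- (t \<bullet> sum_list w)) * (\<Sum>v\<leftarrow>X. exp (- (t \<bullet> v))))"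
      by (simp add: sum_list_map_concat o_def * sum_list_const_mult)
    then show ?case using Suc by (simp add: sum_list_mult_const mult.commute)
  qed simp
  then show ?thesis
    by (simp add: expsum_eq_sum_list family_iteration_def o_def)
qed

lemma sum_list_eq_sum_count:
  fixes f :: "'a \<Rightarrow> real"
  assumes "finite S" "set xs \<subseteq> S"
  shows "sum_list (map f xs) = (\<Sum>x\<in>S. real (count (mset xs) x) * f x)"
  using assms(2)
proof (induction xs)
  case (Cons y xs)
  have "(\<Sum>x\<in>S. real (count (mset (y # xs)) x) * f x) =
      (\<Sum>x\<in>S. real (count (mset xs) x) * f x + (if x = y then f x else 0))"
    by (intro sum.cong) (auto simp: algebra_simps)
  also have "\<dots> = (\<Sum>x\<in>S. real (count (mset xs) x) * f x) + f y"
    using assms(1) Cons.prems by (simp add: sum.distrib)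
  finally show ?case using Cons by simp
qed simp

text \<open>The differences of the multiplicities are the coefficients of a vanishing exponential
  sum.\<close>

lemma mset_eq_if_expsum_eq:
  assumes "\<And>t. expsum U t = expsum V t"
  shows "mset U = mset V"
proof (rule multiset_eqI)
  fix u
  let ?S = "insert u (set U \<union> set V)"
  let ?c = "\<lambda>v. real (count (mset U) v) - real (count (mset V) v)"
  have "(\<Sum>v\<in>?S. ?c v * exp (t \<bullet> v)) = 0" for t
  proof -
    have "sum_list (map (\<lambda>v. exp (t \<bullet> v)) U) = sum_list (map (\<lambda>v. exp (t \<bullet> v)) V)"
      using assms[of "- t"] by (simp add: expsum_eq_sum_list)
    then show ?thesis
      using sum_list_eq_sum_count[of ?S U "\<lambda>v. exp (t \<bullet> v)"] sum_list_eq_sum_count[of ?S V "\<lambda>v. exp (t \<bullet> v)"]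
      by (simp add: left_diff_distrib sum_subtractf subset_insertI2)
  qed
  then have "?c u = 0"
    by (intro exponential_sum_eq_0_imp_coeff_eq_0[of ?S ?c u]) auto
  then show "count (mset U) u = count (mset V) u" by simp
qed

theorem theorem1p6:
  fixes X Y :: "(real ^ 'n) list" and \<eta> \<eta>' :: "real ^ 'n"
  assumes "length X \<ge> 2" and "integral_family X" and "span (set X) = UNIV"
    and "coplanar_family \<eta> X"
    and "length Y \<ge> 2" and "integral_family Y" and "span (set Y) = UNIV"
    and "coplanar_family \<eta>' Y"
    and "same_directional_growth X Y"
  shows "(\<exists>c>0. \<eta> = c *\<^sub>R \<eta>') \<and>
         (\<exists>n\<ge>1. \<exists>n'\<ge>1. mset (family_iteration n X) = mset (family_iteration n' Y))"
proof -
  interpret X: coplanar_lattice_family X \<eta>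
    using assms by unfold_locales
  interpret Y: coplanar_lattice_family Y \<eta>'
    using assms by unfold_locales
  have X: "coplanar_lattice_family X \<eta>" and Y: "coplanar_lattice_family Y \<eta>'"
    by unfold_locales
  obtain c where c: "c > 0" "c \<in> \<rat>" "\<eta> = c *\<^sub>R \<eta>'"
    using same_growth_parallel_normals[OF X Y assms(9)] .
  obtain p :: int and q :: nat where pq: "q \<noteq> 0" "c = of_int p / of_nat q"
    using c(2) by (auto simp: Rats_eq_int_div_nat)
  define n where "n = nat p"
  have "p > 0" using c(1) pq by (simp add: zero_less_divide_iff)
  then have n: "n \<ge> 1" "c * real q = real n"
    using pq by (auto simp: n_def)
  \<comment> \<open>Moving \<open>t\<close> along \<open>\<eta> = c *\<^sub>R \<eta>'\<close> onto
    the common hypersurface shows that \<open>expsum Y t\<close> is the \<open>c\<close>-th power of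
    \<open>expsum X t\<close>; the fraction \<open>c = n / q\<close> is then cleared.\<close>
  have "expsum X t ^ n = expsum Y t ^ q" for t
  proof -
    let ?s = "ln (expsum X t)"
    have "expsum X (t + ?s *\<^sub>R \<eta>) = 1"
      unfolding X.expsum_shift using X.expsum_pos[of t] by (simp add: exp_minus)
    then have "expsum Y (t + ?s *\<^sub>R \<eta>) = 1"
      by (rule same_growth_expsum_eq_1[OF X Y assms(9)])
    then have "exp (- (?s * c)) * expsum Y t = 1"
      using Y.expsum_shift[of t "?s * c"] by (simp add: c(3))
    then have "expsum Y t = exp (?s * c)"
      by (simp add: exp_minus field_simps)
    then have "expsum Y t ^ q = exp (real n * ?s)"
      by (simp add: n(2)[symmetric] mult_ac flip: exp_of_nat_mult)
    then show ?thesis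
      using X.expsum_pos[of t] by (simp add: exp_of_nat_mult)
  qed
  then have "mset (family_iteration n X) = mset (family_iteration q Y)"
    by (intro mset_eq_if_expsum_eq) (simp add: expsum_family_iteration)
  moreover have "q \<ge> 1" using pq(1) by simp
  ultimately show ?thesis using c n(1) by blast
qed

end
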